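(* There exists an absolute constant $c_0>0$ such that the following holds. Let $K,M,T$ be positive integers, let $G=([K],E)$ be a strongly observable directed graph, and define $$\beta_M(G)=\max\Big\{\sum_{c=1}^M |I_c| : I_1,\dots,I_M \text{ disjoint independent subsets of } [K],\ \text{and } I_i\not\to I_j \text{ for } i<j\Big\},$$ where $I_i\not\to I_j$ means that $(u,v)\notin E$ whenever $u\in I_i$ and $v\in I_j$ (the sets $I_c$ may be empty). If $T\ge \beta_M(G)^3$, then the minimax regret satisfies $$R_T^\star(G,M)\ \ge\ c_0\sqrt{\beta_M(G)\,T}.$$
   Context: Graph conventions: $[n]=\{1,\dots,n\}$. For a directed graph $G=([K],E)$ (self-loops allowed), $u\to v$ means $(u,v)\in E$. A set $I\subseteq[K]$ is independent if $(u,v)\notin E$ for all distinct $u,v\in I$. $G$ is strongly observable if for every $a\in[K]$, either $a\to a$ or $a'\to a$ for all $a'\ne a$. Stochastic contextual bandits with graph feedback and complete cross-learning: there are $M$ contexts, $K$ actions, a horizon $T$, and a known feedback graph $G$ on the actions. An environment consists of unknown means $\mu=(\mu_{c,a})_{c\in[M],a\in[K]}\in[0,1]^{M\times K}$ and reward vectors $(r_{t,c,a})_{c\in[M],a\in[K]}$, $t\in[T]$, independent across $t$, with $r_{t,c,a}\in[0,1]$ and $\mathbb{E}[r_{t,c,a}]=\mu_{c,a}$. An oblivious adversary fixes a context sequence $c^T=(c_1,\dots,c_T)\in[M]^T$. In each round $t$, the context $c_t$ is revealed, the learner chooses an action $a_t=\pi_t(c_t)\in[K]$ (possibly at random) based on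 past observations and $c_t$, and then observes $r_{t,c,a}$ for all $c\in[M]$ and all $a$ with $(a_t,a)\in E$. The regret of a policy $\pi$ is $$R_T(\pi;G,M)=\sup_{c^T}\ \sup_{\mu}\ \mathbb{E}\Big[\sum_{t=1}^T\big(\max_{a\in[K]}\mu_{c_t,a}-\mu_{c_t,a_t}\big)\Big],$$ the supremum being over all context sequences and all environments, and $R_T^\star(G,M)=\inf_\pi R_T(\pi;G,M)$ over all such policies.
   Formalization: The formal theorem assumes K ≥ 2 instead of K ≥ 1: for K = 1 the claim is false, since the single action is always optimal so the minimax regret is 0, while β_M(G) = 1 and T ≥ 1 would require 0 ≥ c_0√T > 0. *)

theory Defs
  imports "HOL-Probability.Probability"
begin

text \<open>
  Actions are the elements of \<open>{1..K}\<close>, contexts those of \<open>{1..M}\<close>; rounds are numbered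
  \<open>0, \<dots>, T - 1\<close>. A feedback graph is its edge set \<open>E \<subseteq> {1..K} \<times> {1..K}\<close>, loops allowed.
\<close>

definition strongly_observable :: "nat \<Rightarrow> (nat \<times> nat) set \<Rightarrow> bool" where
  "strongly_observable K E \<longleftrightarrow>
     (\<forall>a\<in>{1..K}. (a, a) \<in> E \<or> (\<forall>a'\<in>{1..K}. a' \<noteq> a \<longrightarrow> (a', a) \<in> E))"

definition independent_in :: "nat \<Rightarrow> (nat \<times> nat) set \<Rightarrow> nat set \<Rightarrow> bool" where
  "independent_in K E I \<longleftrightarrow> I \<subseteq> {1..K} \<and> (\<forall>u\<in>I. \<forall>v\<in>I. u \<noteq> v \<longrightarrow> (u, v) \<notin> E)"

definition no_edge :: "(nat \<times> nat) set \<Rightarrow> nat set \<Rightarrow> nat set \<Rightarrow> bool" where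
  "no_edge E I J \<longleftrightarrow> (\<forall>u\<in>I. \<forall>v\<in>J. (u, v) \<notin> E)"

definition beta :: "nat \<Rightarrow> nat \<Rightarrow> (nat \<times> nat) set \<Rightarrow> nat" where
  "beta K M E = Max {\<Sum>c=1..M. card (I c) | I.
     (\<forall>c\<in>{1..M}. independent_in K E (I c)) \<and>
     disjoint_family_on I {1..M} \<and>
     (\<forall>i\<in>{1..M}. \<forall>j\<in>{1..M}. i < j \<longrightarrow> no_edge E (I i) (I j))}"

text \<open>
  \<open>D t\<close> is the law of the reward vector of round \<open>t\<close>, indexed by (context, action).
  Independence across rounds enters through the product measure in \<open>expected_regret\<close>;
  the laws may differ between rounds, and entries of the same round may be dependent.
\<close>

definition environment ::
  "nat \<Rightarrow> nat \<Rightarrow> nat \<Rightarrow> (nat \<Rightarrow> nat \<Rightarrow> real) \<Rightarrow> (nat \<Rightarrow> (nat \<times> nat \<Rightarrow> real) measure) \<Rightarrow> bool" where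
  "environment K M T \<mu> D \<longleftrightarrow>
     (\<forall>c\<in>{1..M}. \<forall>a\<in>{1..K}. \<mu> c a \<in> {0..1}) \<and>
     (\<forall>t<T. prob_space (D t) \<and>
        sets (D t) = sets (PiM ({1..M} \<times> {1..K}) (\<lambda>_. borel)) \<and>
        (\<forall>c\<in>{1..M}. \<forall>a\<in>{1..K}.
           (AE x in D t. x (c, a) \<in> {0..1}) \<and>
           (\<integral>x. x (c, a) \<partial>D t) = \<mu> c a))"

text \<open>
  A history lists the (context, action) pairs of the past rounds. The coordinates
  (round, context, action) observed along it are those in \<open>observed M E h\<close>:
  all contexts, and all out-neighbours of the action played.
\<close>

type_synonym history = "(nat \<times> nat) list"

definition observed :: "nat \<Rightarrow> (nat \<times> nat) set \<Rightarrow> history \<Rightarrow> (nat \<times> nat \<times> nat) set" where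
  "observed M E h = {(s, c, a). s < length h \<and> c \<in> {1..M} \<and> (snd (h ! s), a) \<in> E}"

text \<open>
  \<open>\<pi> h x c\<close> is the law of the action in round \<open>length h\<close>, given the history \<open>h\<close>,
  the observed rewards \<open>x\<close> and the current context \<open>c\<close>. As \<open>h\<close> contains the past
  actions, drawing afresh in each round is no restriction on how the learner randomizes.
\<close>

type_synonym policy = "history \<Rightarrow> (nat \<times> nat \<times> nat \<Rightarrow> real) \<Rightarrow> nat \<Rightarrow> nat pmf"

definition is_policy :: "nat \<Rightarrow> nat \<Rightarrow> (nat \<times> nat) set \<Rightarrow> policy \<Rightarrow> bool" where
  "is_policy K M E \<pi> \<longleftrightarrow>
     (\<forall>h x c. set_pmf (\<pi> h x c) \<subseteq> {1..K}) \<and>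
     (\<forall>h c a. (\<lambda>x. pmf (\<pi> h x c) a) \<in> borel_measurable (PiM (observed M E h) (\<lambda>_. borel)))"

text \<open>
  The law of the history after \<open>t\<close> rounds, conditionally on all rewards \<open>r\<close>; the
  policy sees only the restriction of \<open>r\<close> to the observed coordinates.
\<close>

primrec play ::
  "nat \<Rightarrow> (nat \<times> nat) set \<Rightarrow> policy \<Rightarrow> (nat \<Rightarrow> nat) \<Rightarrow> (nat \<Rightarrow> nat \<times> nat \<Rightarrow> real) \<Rightarrow> nat
     \<Rightarrow> history pmf" where
  "play M E \<pi> cs r 0 = return_pmf []"
| "play M E \<pi> cs r (Suc t) =
     bind_pmf (play M E \<pi> cs r t) (\<lambda>h.
       map_pmf (\<lambda>a. h @ [(cs t, a)])
         (\<pi> h (restrict (\<lambda>(s, c, a). r s (c, a)) (observed M E h)) (cs t)))"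

definition expected_regret ::
  "nat \<Rightarrow> nat \<Rightarrow> nat \<Rightarrow> (nat \<times> nat) set \<Rightarrow> policy \<Rightarrow> (nat \<Rightarrow> nat) \<Rightarrow> (nat \<Rightarrow> nat \<Rightarrow> real)
     \<Rightarrow> (nat \<Rightarrow> (nat \<times> nat \<Rightarrow> real) measure) \<Rightarrow> real" where
  "expected_regret K M T E \<pi> cs \<mu> D =
     (\<integral>r. measure_pmf.expectation (play M E \<pi> cs r T)
            (\<lambda>h. \<Sum>t<T. Max (\<mu> (cs t) ` {1..K}) - \<mu> (cs t) (snd (h ! t)))
        \<partial>PiM {..<T} D)"

text \<open>
  Expected regrets lie in \<open>[0, T]\<close>, and for \<open>K, M \<ge> 1\<close> environments, context sequences
  and policies exist, so the real \<open>Sup\<close> and \<open>Inf\<close> below are proper.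
\<close>

definition regret :: "nat \<Rightarrow> nat \<Rightarrow> nat \<Rightarrow> (nat \<times> nat) set \<Rightarrow> policy \<Rightarrow> real" where
  "regret K M T E \<pi> =
     Sup {expected_regret K M T E \<pi> cs \<mu> D | cs \<mu> D.
            (\<forall>t<T. cs t \<in> {1..M}) \<and> environment K M T \<mu> D}"

definition minimax_regret :: "nat \<Rightarrow> nat \<Rightarrow> nat \<Rightarrow> (nat \<times> nat) set \<Rightarrow> real" where
  "minimax_regret K M T E = Inf {regret K M T E \<pi> | \<pi>. is_policy K M E \<pi>}"

end

theory Submission imports Defs begin

text \<open>
  Let \<open>I\<^sub>1, \<dots>, I\<^sub>M\<close> attain \<open>\<beta>\<close> and fix an action \<open>b\<close> in the first nonempty \<open>I\<^sub>c\<close>. Context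
  \<open>c\<close> is presented in one block of \<open>n (|I\<^sub>c - {b}|)\<close> rounds, \<open>n \<approx> T / \<beta>\<close>, in increasing order of \<open>c\<close>.
  In context \<open>c\<close> the action \<open>b\<close> is worth \<open>1/2\<close>, the actions of \<open>I\<^sub>c - {b}\<close> are Bernoulli with
  mean \<open>1/2 - \<epsilon>\<close>, except for at most one of mean \<open>1/2 + \<epsilon>\<close>, and all others are worthless;
  \<open>\<epsilon> \<approx> 1 / sqrt n\<close>. By independence and \<open>I\<^sub>i \<not>\<rightarrow> I\<^sub>j\<close> for \<open>i < j\<close>, up to the end of its block an
  action of \<open>I\<^sub>c - {b}\<close> is observed only when it is played in that block or when a worthless
  action is played, at constant cost. If the regret is \<open>O(sqrt (\<beta> T))\<close>, the worthless plays
  contribute \<open>\<epsilon>\<^sup>2 sqrt (\<beta> T) = O(1)\<close> to the divergence because \<open>T \<ge> \<beta>\<^sup>3\<close>, so in each block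
  the learner cannot tell whether \<open>b\<close> is optimal and loses \<open>\<epsilon> n |I\<^sub>c - {b}|\<close> on average over
  independent choices of the good actions. For \<open>\<beta> = 1\<close> a two-point argument with two actions suffices.
\<close>

section \<open>Divergence of discrete laws\<close>

lemma integrable_pmf_bounded:
  fixes f :: "'a \<Rightarrow> real"
  assumes "\<And>x. \<bar>f x\<bar> \<le> B"
  shows "integrable (measure_pmf p) f"
  by (rule measure_pmf.integrable_const_bound[where B = B]) (use assms in auto)

lemma expectation_bind_pmf:
  fixes f :: "'b \<Rightarrow> real"
  assumes "\<And>x. \<bar>f x\<bar> \<le> B"
  shows "measure_pmf.expectation (bind_pmf p k) f =
         measure_pmf.expectation p (\<lambda>x. measure_pmf.expectation (k x) f)"
  unfolding measure_pmf_bind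
  by (rule integral_bind[where K = "count_space UNIV" and B = B and B' = 1])
     (use assms in \<open>auto simp: measure_pmf.emeasure_space_1 measure_pmf_in_subprob_algebra
        intro!: measure_pmf.finite_measure_axioms\<close>)

lemma expectation_pmf_mono:
  fixes f g :: "'a \<Rightarrow> real"
  assumes "\<And>x. x \<in> set_pmf p \<Longrightarrow> f x \<le> g x" "\<And>x. \<bar>f x\<bar> \<le> B" "\<And>x. \<bar>g x\<bar> \<le> B"
  shows "measure_pmf.expectation p f \<le> measure_pmf.expectation p g"
  using integrable_pmf_bounded[OF assms(2), of p] integrable_pmf_bounded[OF assms(3), of p]
  by (intro integral_mono_AE) (auto simp: AE_measure_pmf_iff assms(1))

lemma expectation_pmf_bounds:
  fixes f :: "'a \<Rightarrow> real"
  assumes "\<And>x. a \<le> f x" "\<And>x. f x \<le> b"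
  shows "a \<le> measure_pmf.expectation p f" "measure_pmf.expectation p f \<le> b"
proof -
  have B: "\<bar>f x\<bar> \<le> \<bar>a\<bar> + \<bar>b\<bar>" for x using assms[of x] by linarith
  have "measure_pmf.expectation p (\<lambda>_. a) \<le> measure_pmf.expectation p f"
    by (rule expectation_pmf_mono[where B = "\<bar>a\<bar> + \<bar>b\<bar>"]) (use assms B in auto)
  then show "a \<le> measure_pmf.expectation p f" by simp
  have "measure_pmf.expectation p f \<le> measure_pmf.expectation p (\<lambda>_. b)"
    by (rule expectation_pmf_mono[where B = "\<bar>a\<bar> + \<bar>b\<bar>"]) (use assms B in auto)
  then show "measure_pmf.expectation p f \<le> b" by simp
qed

lemma expectation_pmf_cong:
  fixes f g :: "'a \<Rightarrow> real"
  assumes "\<And>x. x \<in> set_pmf p \<Longrightarrow> f x = g x"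
  shows "measure_pmf.expectation p f = measure_pmf.expectation p g"
  by (rule integral_cong_AE) (auto simp: AE_measure_pmf_iff assms)

text \<open>The dual (Donsker--Varadhan) form of \<open>KL(p, q) \<le> d\<close>. Unlike the divergence itself it
  composes along \<^const>\<open>bind_pmf\<close> by a one-line computation; test functions with values in
  \<open>[1, 2]\<close> suffice below and make all integrability conditions trivial.\<close>

definition kl_le :: "'a pmf \<Rightarrow> 'a pmf \<Rightarrow> real \<Rightarrow> bool" where
  "kl_le p q d \<longleftrightarrow> (\<forall>f. (\<forall>x. 1 \<le> f x \<and> f x \<le> 2) \<longrightarrow>
     measure_pmf.expectation p (\<lambda>x. ln (f x)) - d \<le> ln (measure_pmf.expectation q f))"

lemma kl_le_weaken:
  assumes "kl_le p q d" "d \<le> d'"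
  shows "kl_le p q d'"
  unfolding kl_le_def
proof (intro allI impI)
  fix f :: "'a \<Rightarrow> real" assume "\<forall>x. 1 \<le> f x \<and> f x \<le> 2"
  with assms(1) have "measure_pmf.expectation p (\<lambda>x. ln (f x)) - d \<le> ln (measure_pmf.expectation q f)"
    unfolding kl_le_def by blast
  with assms(2) show "measure_pmf.expectation p (\<lambda>x. ln (f x)) - d' \<le> ln (measure_pmf.expectation q f)"
    by linarith
qed

lemma ln_in_01: "1 \<le> y \<Longrightarrow> y \<le> 2 \<Longrightarrow> 0 \<le> ln y \<and> ln y \<le> (1::real)"
  using ln_add_one_self_le_self[of "y - 1"] by auto

text \<open>Chain rule for the divergence: averaging a test function \<open>f\<close> over
  \<open>l x\<close> gives a test function \<open>f'\<close> for the first stage, again with values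
  in \<open>[1, 2]\<close>. The second-stage divergences \<open>e x\<close> are averaged under
  \<open>p\<close> only; hence observations are later counted under the law with the bad
  arm.\<close>

lemma kl_le_bind:
  assumes pq: "kl_le p q d"
    and k: "\<And>x. x \<in> set_pmf p \<Longrightarrow> kl_le (k x) (l x) (e x)"
    and e: "\<And>x. \<bar>e x\<bar> \<le> B"
  shows "kl_le (bind_pmf p k) (bind_pmf q l) (d + measure_pmf.expectation p e)"
  unfolding kl_le_def
proof (intro allI impI)
  fix f :: "'b \<Rightarrow> real" assume f: "\<forall>x. 1 \<le> f x \<and> f x \<le> 2"
  define f' where "f' x = measure_pmf.expectation (l x) f" for x
  have f': "1 \<le> f' x \<and> f' x \<le> 2" for x
    unfolding f'_def using f expectation_pmf_bounds[of 1 f 2] by blast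
  have lnf: "\<bar>ln (f x)\<bar> \<le> 1" "\<bar>f x\<bar> \<le> 2" for x using ln_in_01[of "f x"] spec[OF f, of x] by auto
  have lnf': "\<bar>ln (f' x)\<bar> \<le> 1" for x using ln_in_01[of "f' x"] f'[of x] by auto
  define g where "g x = measure_pmf.expectation (k x) (\<lambda>y. ln (f y))" for x
  have g: "\<bar>g x\<bar> \<le> 1" for x
    unfolding g_def using expectation_pmf_bounds[of "-1" "\<lambda>y. ln (f y)" 1 "k x"] lnf
    by (auto simp: abs_le_iff minus_le_iff)
  have "measure_pmf.expectation (bind_pmf p k) (\<lambda>x. ln (f x)) = measure_pmf.expectation p g"
    unfolding g_def by (rule expectation_bind_pmf[where B = 1]) (use lnf in auto)
  also have "\<dots> = measure_pmf.expectation p (\<lambda>x. g x - e x) + measure_pmf.expectation p e"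
    using integrable_pmf_bounded[OF g, of p] integrable_pmf_bounded[OF e, of p] by simp
  also have "measure_pmf.expectation p (\<lambda>x. g x - e x) \<le> measure_pmf.expectation p (\<lambda>x. ln (f' x))"
  proof (rule expectation_pmf_mono[where B = "B + 1"])
    fix x show "\<bar>g x - e x\<bar> \<le> B + 1" "\<bar>ln (f' x)\<bar> \<le> B + 1"
      using g[of x] e[of x] lnf'[of x] by linarith+
    show "g x - e x \<le> ln (f' x)" if "x \<in> set_pmf p"
      using k[OF that] f unfolding kl_le_def g_def f'_def by blast
  qed
  also have "\<dots> \<le> ln (measure_pmf.expectation q f') + d"
    using pq f' unfolding kl_le_def by (simp add: algebra_simps)
  also have "measure_pmf.expectation q f' = measure_pmf.expectation (bind_pmf q l) f"
    unfolding f'_def by (rule expectation_bind_pmf[symmetric, where B = 2]) (use lnf in auto)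
  finally show "measure_pmf.expectation (bind_pmf p k) (\<lambda>x. ln (f x)) - (d + measure_pmf.expectation p e)
      \<le> ln (measure_pmf.expectation (bind_pmf q l) f)" by linarith
qed

text \<open>Data processing: composing an admissible test function with \<open>h\<close> gives an
  admissible test function.\<close>

lemma kl_le_map:
  assumes "kl_le p q d"
  shows "kl_le (map_pmf h p) (map_pmf h q) d"
  using assms unfolding kl_le_def by simp

text \<open>The bound is the exact Kullback-Leibler divergence. Jensen's inequality for
  \<open>ln\<close> is applied under \<open>p\<close> to \<open>f\<close> times the likelihood
  ratio; \<open>u\<close> and \<open>v\<close> are its two values.\<close>

lemma kl_le_bernoulli:
  assumes p: "0 < p" "p < 1" and q: "0 < q" "q < 1"
  shows "kl_le (bernoulli_pmf p) (bernoulli_pmf q) (p * ln (p / q) + (1 - p) * ln ((1 - p) / (1 - q)))"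
  unfolding kl_le_def
proof (intro allI impI)
  fix f :: "bool \<Rightarrow> real" assume f: "\<forall>x. 1 \<le> f x \<and> f x \<le> 2"
  have f0: "f x > 0" for x using spec[OF f, of x] by linarith
  define u where "u = q * f True / p"
  define v where "v = (1 - q) * f False / (1 - p)"
  have "concave_on {0<..} (ln :: real \<Rightarrow> real)" by (rule ln_concave)
  then have "ln ((1 - p) *\<^sub>R v + p *\<^sub>R u) \<ge> (1 - p) * ln v + p * ln u"
    by (rule concave_onD) (use p q f0 in \<open>auto simp: u_def v_def\<close>)
  moreover have "ln u = ln (f True) - ln (p / q)"
    using p q f0[of True] by (simp add: u_def ln_mult ln_div)
  moreover have "ln v = ln (f False) - ln ((1 - p) / (1 - q))"
    using p q f0[of False] by (simp add: v_def ln_mult ln_div)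
  moreover have "p * u = q * f True" "(1 - p) * v = (1 - q) * f False"
    using p by (simp_all add: u_def v_def)
  then have "(1 - p) *\<^sub>R v + p *\<^sub>R u = measure_pmf.expectation (bernoulli_pmf q) f"
    using q by simp
  ultimately show "measure_pmf.expectation (bernoulli_pmf p) (\<lambda>x. ln (f x)) -
      (p * ln (p / q) + (1 - p) * ln ((1 - p) / (1 - q))) \<le> ln (measure_pmf.expectation (bernoulli_pmf q) f)"
    using p by (simp add: algebra_simps)
qed

text \<open>Jensen's inequality for \<open>ln\<close>, obtained from the tangent at the mean
  \<open>m\<close> of \<open>f\<close>.\<close>

lemma kl_le_refl: "kl_le p p 0"
  unfolding kl_le_def
proof (intro allI impI)
  fix f :: "'a \<Rightarrow> real" assume f: "\<forall>x. 1 \<le> f x \<and> f x \<le> 2"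
  define m where "m = measure_pmf.expectation p f"
  have m: "1 \<le> m" unfolding m_def using f expectation_pmf_bounds(1)[of 1 f 2] by blast
  have lnf: "\<bar>ln (f x)\<bar> \<le> 1" "\<bar>f x\<bar> \<le> 2" for x using ln_in_01[of "f x"] spec[OF f, of x] by auto
  have i: "integrable (measure_pmf p) f" by (rule integrable_pmf_bounded) (rule lnf)
  have "measure_pmf.expectation p (\<lambda>x. ln (f x)) \<le> measure_pmf.expectation p (\<lambda>x. ln m + (f x / m - 1))"
  proof (rule integral_mono)
    show "integrable (measure_pmf p) (\<lambda>x. ln (f x))"
      by (rule integrable_pmf_bounded) (rule lnf)
    show "integrable (measure_pmf p) (\<lambda>x. ln m + (f x / m - 1))" using i by auto
    fix x have "ln (f x / m) \<le> f x / m - 1"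
      using m spec[OF f, of x] by (intro ln_le_minus_one) auto
    then show "ln (f x) \<le> ln m + (f x / m - 1)"
      using m spec[OF f, of x] by (simp add: ln_div)
  qed
  also have "\<dots> = ln m" using m i by (simp add: m_def)
  finally show "measure_pmf.expectation p (\<lambda>x. ln (f x)) - 0 \<le> ln (measure_pmf.expectation p f)"
    by (simp add: m_def)
qed

text \<open>Testing with \<open>1 + g\<close> bounds the sum of the two error probabilities from below.\<close>

lemma kl_le_two_point:
  assumes "kl_le p q d" and g: "\<And>x. 0 \<le> g x" "\<And>x. g x \<le> 1"
  shows "measure_pmf.expectation q g + measure_pmf.expectation p (\<lambda>x. 1 - g x) \<ge> ln 2 - d"
proof -
  have i: "integrable (measure_pmf r) g" for r
    by (rule integrable_pmf_bounded[where B = 1]) (use g in \<open>auto simp: abs_le_iff intro: order_trans[of _ 0]\<close>)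
  have Eg: "0 \<le> measure_pmf.expectation r g" "measure_pmf.expectation r g \<le> 1" for r
    using expectation_pmf_bounds[of 0 g 1 r] g by auto
  \<comment> \<open>The chord of \<open>ln (1 + y)\<close> between 0 and 1 lies below the graph;
    this turns the logarithmic term into a multiple of the expectation of \<open>g\<close>.\<close>
  have conc: "ln 2 * y \<le> ln (1 + y)" if "0 \<le> y" "y \<le> 1" for y :: real
  proof -
    have "concave_on {0<..} (ln :: real \<Rightarrow> real)" by (rule ln_concave)
    then have "ln ((1 - y) *\<^sub>R 1 + y *\<^sub>R 2) \<ge> (1 - y) * ln 1 + y * ln (2::real)"
      by (rule concave_onD) (use that in auto)
    then show ?thesis by (simp add: algebra_simps)
  qed
  have "measure_pmf.expectation p (\<lambda>x. ln 2 * g x) \<le> measure_pmf.expectation p (\<lambda>x. ln (1 + g x))"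
  proof (rule expectation_pmf_mono[where B = 1])
    fix x
    have "ln (1 + g x) \<in> {0..1}" using ln_in_01[of "1 + g x"] g[of x] by auto
    then show "\<bar>ln (1 + g x)\<bar> \<le> 1" by auto
    have "0 \<le> ln 2 * g x" using g[of x] by auto
    moreover have "ln 2 * g x \<le> 1 * 1"
      using g[of x] ln_in_01[of 2] by (intro mult_mono) auto
    ultimately
    show "\<bar>ln 2 * g x\<bar> \<le> 1" by auto
  qed (use conc g in auto)
  also have "\<dots> \<le> ln (measure_pmf.expectation q (\<lambda>x. 1 + g x)) + d"
    using assms(1) g unfolding kl_le_def by (simp add: algebra_simps)
  also have "measure_pmf.expectation q (\<lambda>x. 1 + g x) = 1 + measure_pmf.expectation q g"
    using i by simp
  also have "ln (1 + measure_pmf.expectation q g) \<le> measure_pmf.expectation q g"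
    using Eg by (intro ln_add_one_self_le_self) auto
  finally have "ln 2 * measure_pmf.expectation p g \<le> measure_pmf.expectation q g + d" by simp
  moreover have "ln 2 * (1 - measure_pmf.expectation p g) \<le> 1 * (1 - measure_pmf.expectation p g)"
    using Eg ln_in_01[of 2] by (intro mult_right_mono) auto
  moreover have "measure_pmf.expectation p (\<lambda>x. 1 - g x) = 1 - measure_pmf.expectation p g"
    using i by simp
  ultimately show ?thesis by (simp add: algebra_simps)
qed

text \<open>Once the coordinate \<alpha> is split off, the remaining factors are identical and
  contribute zero divergence.\<close>

lemma kl_le_Pi_pmf_coordinate:
  assumes "finite A" "\<alpha> \<in> A" "kl_le (p \<alpha>) (q \<alpha>) d" "\<And>a. a \<in> A \<Longrightarrow> a \<noteq> \<alpha> \<Longrightarrow> p a = q a"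
  shows "kl_le (Pi_pmf A dflt p) (Pi_pmf A dflt q) d"
proof -
  define A' where "A' = A - {\<alpha>}"
  have A: "A = insert \<alpha> A'" "finite A'" "\<alpha> \<notin> A'" using assms by (auto simp: A'_def)
  have *: "Pi_pmf A dflt r = bind_pmf (r \<alpha>) (\<lambda>y. bind_pmf (Pi_pmf A' dflt r) (\<lambda>f. return_pmf (f(\<alpha> := y))))"
    for r unfolding A(1) using A(2,3) by (rule Pi_pmf_insert')
  have eq: "Pi_pmf A' dflt p = Pi_pmf A' dflt q"
    by (rule Pi_pmf_cong) (use assms A in auto)
  have "kl_le (Pi_pmf A dflt p) (Pi_pmf A dflt q) (d + measure_pmf.expectation (p \<alpha>) (\<lambda>_. 0))"
    unfolding * eq by (rule kl_le_bind[where B = 0, OF assms(3) kl_le_refl]) auto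
  then show ?thesis by simp
qed

lemma bernoulli_divergence_le:
  assumes "0 \<le> \<epsilon>" "\<epsilon> \<le> 1/4"
  shows "kl_le (bernoulli_pmf (1/2 - \<epsilon>)) (bernoulli_pmf (1/2 + \<epsilon>)) (16 * \<epsilon>\<^sup>2)"
proof -
  let ?p = "1/2 - \<epsilon>" and ?q = "1/2 + \<epsilon>"
  have pos: "?p \<ge> 1/4" "?q > 0" using assms by auto
  have eq: "?p * ln (?p / ?q) + (1 - ?p) * ln ((1 - ?p) / (1 - ?q)) = 2 * \<epsilon> * ln (?q / ?p)"
  proof -
    have "1 - ?p = ?q" "1 - ?q = ?p" by simp_all
    moreover have "ln (?p / ?q) = - ln (?q / ?p)" using pos by (simp add: ln_div)
    ultimately show ?thesis by (simp only:) (simp add: algebra_simps)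
  qed
  have "ln (?q / ?p) \<le> ?q / ?p - 1" using pos by (intro ln_le_minus_one) auto
  also have "\<dots> = 2 * \<epsilon> / ?p" using pos by (simp add: field_simps)
  also have "\<dots> \<le> 2 * \<epsilon> / (1/4)" using pos assms by (intro divide_left_mono) auto
  finally have "2 * \<epsilon> * ln (?q / ?p) \<le> 2 * \<epsilon> * (8 * \<epsilon>)" using assms by (intro mult_left_mono) auto
  then have le: "?p * ln (?p / ?q) + (1 - ?p) * ln ((1 - ?p) / (1 - ?q)) \<le> 16 * \<epsilon>\<^sup>2"
    unfolding eq by (simp add: power2_eq_square)
  have "kl_le (bernoulli_pmf ?p) (bernoulli_pmf ?q)
     (?p * ln (?p / ?q) + (1 - ?p) * ln ((1 - ?p) / (1 - ?q)))"
    by (rule kl_le_bernoulli) (use assms in auto)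
  then show ?thesis by (rule kl_le_weaken) (rule le)
qed

section \<open>Play against random rewards\<close>

lemma set_pmf_play:
  assumes "is_policy K M E \<pi>" "h \<in> set_pmf (play M E \<pi> cs r t)"
  shows "length h = t \<and> (\<forall>s<t. fst (h ! s) = cs s \<and> snd (h ! s) \<in> {1..K})"
  using assms(2)
proof (induction t arbitrary: h)
  case (Suc t)
  then obtain h' a x where h: "h' \<in> set_pmf (play M E \<pi> cs r t)" "h = h' @ [(cs t, a)]"
      "a \<in> set_pmf (\<pi> h' x (cs t))" by auto
  then have "a \<in> {1..K}" using assms(1) unfolding is_policy_def by blast
  then show ?case using Suc.IH[OF h(1)] h(2) by (auto simp: nth_append less_Suc_eq)
qed auto

lemma length_play:
  assumes "h \<in> set_pmf (play M E \<pi> cs r t)"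
  shows "length h = t"
  using assms by (induction t arbitrary: h) auto

text \<open>A policy reads rewards only at observed coordinates, all of which have an earlier round,
  a context in \<open>{1..M}\<close> and an edge target as action. \<open>B\<close> is any set
  containing the edge targets.\<close>

lemma play_cong:
  assumes "E \<subseteq> UNIV \<times> B"
    and "\<And>s c a. s < t \<Longrightarrow> c \<in> {1..M} \<Longrightarrow> a \<in> B \<Longrightarrow> r s (c, a) = r' s (c, a)"
  shows "play M E \<pi> cs r t = play M E \<pi> cs r' t"
  using assms(2)
proof (induction t)
  case (Suc t)
  have IH: "play M E \<pi> cs r t = play M E \<pi> cs r' t"
    by (rule Suc.IH) (use Suc.prems in auto)
  show ?case unfolding play.simps IH
  proof (rule bind_pmf_cong[OF refl])
    fix h assume "h \<in> set_pmf (play M E \<pi> cs r' t)"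
    then have "length h = t" by (rule length_play)
    then have "restrict (\<lambda>(s, c, a). r s (c, a)) (observed M E h) =
        restrict (\<lambda>(s, c, a). r' s (c, a)) (observed M E h)"
      using Suc.prems assms(1) by (intro restrict_ext) (auto simp: observed_def)
    then show "map_pmf (\<lambda>a. h @ [(cs t, a)]) (\<pi> h (restrict (\<lambda>(s, c, a). r s (c, a)) (observed M E h)) (cs t)) =
      map_pmf (\<lambda>a. h @ [(cs t, a)]) (\<pi> h (restrict (\<lambda>(s, c, a). r' s (c, a)) (observed M E h)) (cs t))"
      by simp
  qed
qed simp

text \<open>A history determines its own prefix, so only \<open>h\<close> contributes to the mixture
  over prefixes.\<close>

lemma pmf_play_Suc:
  "pmf (play M E \<pi> cs r (Suc t)) (h @ [(c, a)]) =
    (if c = cs t then pmf (play M E \<pi> cs r t) h *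
       pmf (\<pi> h (restrict (\<lambda>(s, c, a). r s (c, a)) (observed M E h)) (cs t)) a else 0)"
proof -
  define P where "P h = \<pi> h (restrict (\<lambda>(s, c, a). r s (c, a)) (observed M E h)) (cs t)" for h
  have z: "pmf (map_pmf (\<lambda>a. h' @ [(cs t, a)]) (P h')) (h @ [(c, a)]) = 0" if "h' \<noteq> h \<or> c \<noteq> cs t" for h'
    using that by (intro pmf_map_outside) auto
  have "pmf (play M E \<pi> cs r (Suc t)) (h @ [(c, a)]) =
      measure_pmf.expectation (play M E \<pi> cs r t)
        (\<lambda>h'. pmf (map_pmf (\<lambda>a. h' @ [(cs t, a)]) (P h')) (h @ [(c, a)]))"
    by (simp add: pmf_bind P_def)
  also have "\<dots> = (\<Sum>h'\<in>{h}. pmf (map_pmf (\<lambda>a. h' @ [(cs t, a)]) (P h')) (h @ [(c, a)]) * pmf (play M E \<pi> cs r t) h')"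
    by (rule integral_measure_pmf_real) (use z in auto)
  also have "\<dots> = (if c = cs t then pmf (play M E \<pi> cs r t) h * pmf (P h) a else 0)"
  proof (cases "c = cs t")
    case True
    have "pmf (map_pmf (\<lambda>a. h @ [(cs t, a)]) (P h)) (h @ [(cs t, a)]) = pmf (P h) a"
      using pmf_map_inj'[of "\<lambda>a. h @ [(cs t, a)]" "P h" a] by (simp add: inj_def)
    with True show ?thesis by simp
  next
    case False then show ?thesis using z by simp
  qed
  finally show ?thesis by (simp add: P_def)
qed

section \<open>Measurability in the rewards\<close>

lemma measurable_pmf_play:
  assumes pol: "is_policy K M E \<pi>" and E: "E \<subseteq> {1..K} \<times> {1..K}" and "t \<le> T"
  shows "(\<lambda>r. pmf (play M E \<pi> cs r t) h) \<in>
    borel_measurable (PiM {..<T} (\<lambda>_. PiM ({1..M} \<times> {1..K}) (\<lambda>_. borel)))" (is "_ \<in> borel_measurable ?N")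
  using \<open>t \<le> T\<close>
proof (induction t arbitrary: h)
  case (Suc t)
  show ?case
  proof (cases h rule: rev_cases)
    case Nil
    have "pmf (play M E \<pi> cs r (Suc t)) h = 0" for r
      using length_play[of h M E \<pi> cs r "Suc t"] Nil by (auto simp: pmf_eq_0_set_pmf simp del: play.simps)
    then show ?thesis by (simp del: play.simps)
  next
    case (snoc h' y)
    obtain c a where y: "y = (c, a)" by force
    have IH[measurable]: "(\<lambda>r. pmf (play M E \<pi> cs r t) h') \<in> borel_measurable ?N"
      by (rule Suc.IH) (use Suc.prems in simp)
    \<comment> \<open>The length bound keeps every observed round below \<open>T\<close>, inside the
      index set of the product measure. Prefixes of a length other than \<open>t\<close> have
      probability 0 and are treated separately.\<close>
    have [measurable]: "(\<lambda>r. pmf (\<pi> h' (restrict (\<lambda>(s, c, a). r s (c, a)) (observed M E h')) (cs t)) a) \<in> borel_measurable ?N"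
      if "length h' \<le> T"
    proof -
      have "(\<lambda>r. restrict (\<lambda>(s, c, a). r s (c, a)) (observed M E h')) \<in> measurable ?N (PiM (observed M E h') (\<lambda>_. borel))"
      proof (rule measurable_restrict)
        fix i assume "i \<in> observed M E h'"
        then obtain s c a where i: "i = (s, c, a)" "s < length h'" "c \<in> {1..M}" "(snd (h' ! s), a) \<in> E"
          by (auto simp: observed_def)
        then have i': "s < T" "a \<in> {1..K}" using that E by auto
        have "(\<lambda>r. r s) \<in> measurable ?N (PiM ({1..M} \<times> {1..K}) (\<lambda>_. borel))"
          using i i' by (intro measurable_component_singleton) auto
        moreover have "(\<lambda>x. x (c, a)) \<in> measurable (PiM ({1..M} \<times> {1..K}) (\<lambda>_. borel)) borel"
          using i i' by (intro measurable_component_singleton) auto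
        ultimately have "(\<lambda>r. r s (c, a)) \<in> measurable ?N borel" by (rule measurable_compose)
        then show "(\<lambda>r. case i of (s, c, a) \<Rightarrow> r s (c, a)) \<in> measurable ?N borel" by (simp add: i)
      qed
      moreover have "(\<lambda>x. pmf (\<pi> h' x (cs t)) a) \<in> borel_measurable (PiM (observed M E h') (\<lambda>_. borel))"
        using pol unfolding is_policy_def by blast
      ultimately show ?thesis by (rule measurable_compose)
    qed
    show ?thesis
    proof (cases "length h' = t")
      case True
      then have "length h' \<le> T" using Suc.prems by simp
      then show ?thesis unfolding snoc y pmf_play_Suc by measurable
    next
      case False
      then have "pmf (play M E \<pi> cs r t) h' = 0" for r
        using length_play[of h' M E \<pi> cs r t] by (auto simp: pmf_eq_0_set_pmf)
      then show ?thesis unfolding snoc y pmf_play_Suc by (cases "c = cs t") simp_all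
    qed
  qed
qed simp

text \<open>Only finitely many histories can occur, uniformly in the rewards, so the expectation is
  a finite sum of measurable point probabilities.\<close>

lemma measurable_expectation_play:
  fixes f :: "history \<Rightarrow> real"
  assumes pol: "is_policy K M E \<pi>" and E: "E \<subseteq> {1..K} \<times> {1..K}"
  shows "(\<lambda>r. measure_pmf.expectation (play M E \<pi> cs r T) f) \<in>
    borel_measurable (PiM {..<T} (\<lambda>_. PiM ({1..M} \<times> {1..K}) (\<lambda>_. borel)))"
proof -
  define H where "H = {h. set h \<subseteq> cs ` {..<T} \<times> {1..K} \<and> length h = T}"
  have fin: "finite H" unfolding H_def by (intro finite_lists_length_eq) auto
  have "h \<in> H" if "h \<in> set_pmf (play M E \<pi> cs r T)" for h r
    using set_pmf_play[OF pol that] unfolding H_def by (force simp: in_set_conv_nth)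
  then have eq: "measure_pmf.expectation (play M E \<pi> cs r T) f = (\<Sum>h\<in>H. f h * pmf (play M E \<pi> cs r T) h)" for r
    by (intro integral_measure_pmf_real fin) auto
  show ?thesis unfolding eq
    using measurable_pmf_play[OF pol E order.refl] by measurable
qed

text \<open>Turns the integral over \<open>PiM\<close> in the regret into an expectation over
  \<open>Pi_pmf\<close>. The two measures agree on boxes, which determine a finite product.\<close>

lemma PiM_distr_pmf:
  fixes Q :: "'y pmf" and val :: "'y \<Rightarrow> 'b"
  assumes fin: "finite I" and val: "\<And>y. val y \<in> space S"
  defines "D \<equiv> distr (measure_pmf Q) S val"
  shows "PiM I (\<lambda>_. D) = distr (measure_pmf (Pi_pmf I d (\<lambda>_. Q))) (PiM I (\<lambda>_. S)) (\<lambda>x. restrict (\<lambda>s. val (x s)) I)"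
proof -
  have vm: "val \<in> measurable (measure_pmf Q) S" using val by simp
  interpret D: prob_space D unfolding D_def
    by (rule measure_pmf.prob_space_distr[OF vm])
  interpret product_sigma_finite "\<lambda>_. D" by standard
  have sD: "sets D = sets S" by (simp add: D_def)
  have rm: "(\<lambda>x. restrict (\<lambda>s. val (x s)) I) \<in> measurable (measure_pmf (Pi_pmf I d (\<lambda>_. Q))) (PiM I (\<lambda>_. S))"
    using val by (auto simp: space_PiM)
  show ?thesis
  proof (rule PiM_eqI[OF fin, symmetric])
    show "sets (distr (measure_pmf (Pi_pmf I d (\<lambda>_. Q))) (PiM I (\<lambda>_. S)) (\<lambda>x. restrict (\<lambda>s. val (x s)) I))
        = sets (PiM I (\<lambda>_. D))"
      by (simp add: sD cong: sets_PiM_cong)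
    fix B assume B: "\<And>i. i \<in> I \<Longrightarrow> B i \<in> sets D"
    have "emeasure (distr (measure_pmf (Pi_pmf I d (\<lambda>_. Q))) (PiM I (\<lambda>_. S)) (\<lambda>x. restrict (\<lambda>s. val (x s)) I)) (Pi\<^sub>E I B)
      = emeasure (measure_pmf (Pi_pmf I d (\<lambda>_. Q))) (Pi I (\<lambda>i. val -` B i))"
      using B sD rm fin by (subst emeasure_distr) (auto intro!: sets_PiM_I_finite arg_cong2[where f = emeasure] simp: Pi_iff)
    also have "\<dots> = ennreal (\<Prod>i\<in>I. measure_pmf.prob Q (val -` B i))"
      using measure_Pi_pmf_Pi[OF fin, of d "\<lambda>_. Q" "\<lambda>i. val -` B i"]
      by (simp add: measure_pmf.emeasure_eq_measure)
    also have "\<dots> = (\<Prod>i\<in>I. emeasure D (B i))"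
      using B sD vm by (simp add: prod_ennreal[symmetric] D_def emeasure_distr measure_pmf.emeasure_eq_measure)
    finally show "emeasure (distr (measure_pmf (Pi_pmf I d (\<lambda>_. Q))) (PiM I (\<lambda>_. S)) (\<lambda>x. restrict (\<lambda>s. val (x s)) I)) (Pi\<^sub>E I B)
       = (\<Prod>i\<in>I. emeasure D (B i))" .
  qed
qed

definition rounds_regret :: "nat \<Rightarrow> nat \<Rightarrow> (nat \<Rightarrow> nat) \<Rightarrow> (nat \<Rightarrow> nat \<Rightarrow> real) \<Rightarrow> history \<Rightarrow> real" where
  "rounds_regret K T cs \<mu> h = (\<Sum>t<T. Max (\<mu> (cs t) ` {1..K}) - \<mu> (cs t) (snd (h ! t)))"

lemma expected_regret_pmf:
  fixes Q :: "'y pmf" and val :: "'y \<Rightarrow> nat \<times> nat \<Rightarrow> real"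
  assumes pol: "is_policy K M E \<pi>" and E: "E \<subseteq> {1..K} \<times> {1..K}"
  defines "S \<equiv> {1..M} \<times> {1..K}"
  shows "expected_regret K M T E \<pi> cs \<mu> (\<lambda>_. distr (measure_pmf Q) (PiM S (\<lambda>_. borel)) (\<lambda>y. restrict (val y) S)) =
    measure_pmf.expectation (Pi_pmf {..<T} d (\<lambda>_. Q)) (\<lambda>x.
      measure_pmf.expectation (play M E \<pi> cs (\<lambda>s. val (x s)) T) (rounds_regret K T cs \<mu>))"
proof -
  let ?S = "PiM S (\<lambda>_. borel :: real measure)"
  have eq: "PiM {..<T} (\<lambda>_. distr (measure_pmf Q) ?S (\<lambda>y. restrict (val y) S)) =
    distr (measure_pmf (Pi_pmf {..<T} d (\<lambda>_. Q))) (PiM {..<T} (\<lambda>_. ?S)) (\<lambda>x. restrict (\<lambda>s. restrict (val (x s)) S) {..<T})"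
    by (rule PiM_distr_pmf) (auto simp: space_PiM)
  have "expected_regret K M T E \<pi> cs \<mu> (\<lambda>_. distr (measure_pmf Q) ?S (\<lambda>y. restrict (val y) S)) =
     measure_pmf.expectation (Pi_pmf {..<T} d (\<lambda>_. Q)) (\<lambda>x.
      measure_pmf.expectation (play M E \<pi> cs (restrict (\<lambda>s. restrict (val (x s)) S) {..<T}) T) (rounds_regret K T cs \<mu>))"
    unfolding expected_regret_def rounds_regret_def[symmetric] eq
    by (subst integral_distr)
       (use measurable_expectation_play[OF pol E, of cs T] in \<open>auto simp: space_PiM S_def\<close>)
  \<comment> \<open>The restrictions are invisible to the policy, because all edges stay inside
    \<open>{1..K}\<close> and only rounds below \<open>T\<close> are read.\<close>
  moreover have "play M E \<pi> cs (restrict (\<lambda>s. restrict (val (x s)) S) {..<T}) T = play M E \<pi> cs (\<lambda>s. val (x s)) T" for x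
    by (rule play_cong[where B = "{1..K}"]) (use E in \<open>auto simp: S_def\<close>)
  ultimately show ?thesis by simp
qed

section \<open>Bernoulli environments\<close>

text \<open>Each unknown arm \<open>a\<close> of \<open>A\<close> is random only in its own context
  \<open>ctx a\<close>; \<open>b\<close> pays exactly 1/2 in every context, so its reward carries no
  information. Cross-learning lets the bit of an arm be observed during any context.\<close>

locale bernoulli_bandit =
  fixes K M :: nat and E :: "(nat \<times> nat) set" and \<pi> :: policy and cs :: "nat \<Rightarrow> nat"
    and A :: "nat set" and b :: nat and ctx :: "nat \<Rightarrow> nat"
  assumes policy: "is_policy K M E \<pi>"
    and E_sub: "E \<subseteq> {1..K} \<times> {1..K}"
    and A_sub: "A \<subseteq> {1..K}"
    and b_in: "b \<in> {1..K}" and b_notin: "b \<notin> A"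
    and ctx_in: "\<And>a. a \<in> A \<Longrightarrow> ctx a \<in> {1..M}"
begin

lemma finite_A: "finite A" using A_sub finite_subset by blast

definition arms :: "nat \<Rightarrow> nat set" where "arms c = {a \<in> A. ctx a = c}"

lemma arms_iff: "a \<in> arms c \<longleftrightarrow> a \<in> A \<and> ctx a = c" by (simp add: arms_def)

lemma finite_arms: "finite (arms c)" using finite_A by (simp add: arms_def)

text \<open>One bit per arm and round encodes the whole reward vector; only the bits of
  \<open>A\<close> enter.\<close>

definition entry :: "(nat \<Rightarrow> bool) \<Rightarrow> nat \<times> nat \<Rightarrow> real" where
  "entry y = (\<lambda>(c, a). if a \<in> A \<and> ctx a = c then of_bool (y a) else if a = b then 1/2 else 0)"

definition bits :: "(nat \<Rightarrow> real) \<Rightarrow> nat set \<Rightarrow> (nat \<Rightarrow> bool) pmf" where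
  "bits p B = Pi_pmf B False (\<lambda>a. bernoulli_pmf (p a))"

definition mean :: "(nat \<Rightarrow> real) \<Rightarrow> nat \<Rightarrow> nat \<Rightarrow> real" where
  "mean p c a = (if a \<in> A \<and> ctx a = c then p a else if a = b then 1/2 else 0)"

definition reward_law :: "(nat \<Rightarrow> real) \<Rightarrow> (nat \<times> nat \<Rightarrow> real) measure" where
  "reward_law p = distr (measure_pmf (bits p A)) (PiM ({1..M} \<times> {1..K}) (\<lambda>_. borel))
     (\<lambda>y. restrict (entry y) ({1..M} \<times> {1..K}))"

lemma environment_reward_law:
  assumes "\<And>a. a \<in> A \<Longrightarrow> p a \<in> {0..1}"
  shows "environment K M T (mean p) (\<lambda>_. reward_law p)"
proof -
  have m: "(\<lambda>y. restrict (entry y) ({1..M} \<times> {1..K})) \<in>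
      measurable (measure_pmf (bits p A)) (PiM ({1..M} \<times> {1..K}) (\<lambda>_. borel))"
    by (auto simp: space_PiM)
  have comp: "(\<lambda>x. x (c, a)) \<in> borel_measurable (PiM ({1..M} \<times> {1..K}) (\<lambda>_. borel :: real measure))"
    if "c \<in> {1..M}" "a \<in> {1..K}" for c a
    using that by (intro measurable_component_singleton) auto
  have "(\<integral>x. x (c, a) \<partial>reward_law p) = mean p c a" if "c \<in> {1..M}" "a \<in> {1..K}" for c a
  proof -
    have "(\<integral>x. x (c, a) \<partial>reward_law p) = measure_pmf.expectation (bits p A) (\<lambda>y. entry y (c, a))"
      unfolding reward_law_def using that by (subst integral_distr[OF m comp]) auto
    also have "\<dots> = mean p c a"
    proof (cases "a \<in> A \<and> ctx a = c")
      case True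
      have "measure_pmf.expectation (bits p A) (\<lambda>y. entry y (c, a)) =
          measure_pmf.expectation (map_pmf (\<lambda>y. y a) (bits p A)) (\<lambda>v. of_bool v)"
        using True by (simp add: entry_def)
      also have "map_pmf (\<lambda>y. y a) (bits p A) = bernoulli_pmf (p a)"
        unfolding bits_def using True finite_A by (simp add: Pi_pmf_component)
      finally show ?thesis using True assms by (simp add: mean_def)
    qed (auto simp: entry_def mean_def)
    finally show ?thesis .
  qed
  moreover have "AE x in reward_law p. x (c, a) \<in> {0..1}" if "c \<in> {1..M}" "a \<in> {1..K}" for c a
  proof -
    have [measurable]: "(\<lambda>x. x (c, a)) \<in> borel_measurable (PiM ({1..M} \<times> {1..K}) (\<lambda>_. borel :: real measure))"
      using that by (rule comp)
    show ?thesis unfolding reward_law_def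
      by (subst AE_distr_iff[OF m]) (use that in \<open>auto simp: entry_def\<close>)
  qed
  moreover have "prob_space (reward_law p)"
    unfolding reward_law_def by (rule measure_pmf.prob_space_distr[OF m])
  ultimately show ?thesis
    unfolding environment_def using assms by (auto simp: mean_def reward_law_def)
qed

definition seen :: "nat \<Rightarrow> nat set" where "seen a = {\<alpha> \<in> A. (a, \<alpha>) \<in> E}"

definition choice :: "nat \<Rightarrow> history \<Rightarrow> (nat \<Rightarrow> nat \<Rightarrow> bool) \<Rightarrow> nat pmf" where
  "choice t h x = \<pi> h (restrict (\<lambda>(s, c, a). entry (x s) (c, a)) (observed M E h)) (cs t)"

text \<open>The interaction with rewards drawn round by round and only where they are observed;
  unobserved bits are recorded as \<^const>\<open>False\<close>.\<close>

primrec run :: "(nat \<Rightarrow> real) \<Rightarrow> nat \<Rightarrow> (history \<times> (nat \<Rightarrow> nat \<Rightarrow> bool)) pmf" where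
  "run p 0 = return_pmf ([], \<lambda>_ _. False)"
| "run p (Suc t) = bind_pmf (run p t) (\<lambda>(h, x). bind_pmf (choice t h x) (\<lambda>a.
     map_pmf (\<lambda>y. (h @ [(cs t, a)], x(t := y))) (bits p (seen a))))"

text \<open>The part of a full table of bits that \<open>run\<close> would have recorded along
  \<open>h\<close>; it couples \<open>play\<close> with \<open>run\<close>.\<close>

definition mask :: "history \<Rightarrow> (nat \<Rightarrow> nat \<Rightarrow> bool) \<Rightarrow> nat \<Rightarrow> nat \<Rightarrow> bool" where
  "mask h x = (\<lambda>s \<alpha>. s < length h \<and> \<alpha> \<in> seen (snd (h ! s)) \<and> x s \<alpha>)"

lemma bits_seen: "map_pmf (\<lambda>y \<alpha>. \<alpha> \<in> seen a \<and> y \<alpha>) (bits p A) = bits p (seen a)"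
proof -
  have "bits p (seen a) = map_pmf (\<lambda>f x. if x \<in> seen a then f x else False) (bits p A)"
    unfolding bits_def by (rule Pi_pmf_subset) (auto simp: finite_A seen_def)
  moreover have "(\<lambda>(f::nat \<Rightarrow> bool) x. if x \<in> seen a then f x else False) = (\<lambda>y \<alpha>. \<alpha> \<in> seen a \<and> y \<alpha>)"
    by (intro ext) auto
  ultimately show ?thesis by simp
qed

lemma entry_cong: "(a \<in> A \<Longrightarrow> y a = y' a) \<Longrightarrow> entry y (c, a) = entry y' (c, a)"
  by (auto simp: entry_def)

text \<open>Principle of deferred decisions: the policy depends on the rewards only through the
  masked bits, so the bits of a round may be drawn after its action and the unobserved ones
  integrated out.\<close>

lemma run_eq_play:
  "bind_pmf (Pi_pmf {..<t} (\<lambda>_. False) (\<lambda>_. bits p A)) (\<lambda>x.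
     map_pmf (\<lambda>h. (h, mask h x)) (play M E \<pi> cs (\<lambda>s. entry (x s)) t)) = run p t"
proof (induction t)
  case 0
  show ?case by (simp add: mask_def)
next
  case (Suc t)
  let ?P = "Pi_pmf {..<t} (\<lambda>_. False) (\<lambda>_. bits p A)"
  let ?W = "\<lambda>y (h, x). bind_pmf (choice t h x)
      (\<lambda>a. return_pmf (h @ [(cs t, a)], x(t := (\<lambda>\<alpha>. \<alpha> \<in> seen a \<and> y \<alpha>))))"
  have step: "map_pmf (\<lambda>h. (h, mask h (x(t := y)))) (play M E \<pi> cs (\<lambda>s. entry ((x(t := y)) s)) (Suc t)) =
     bind_pmf (map_pmf (\<lambda>h. (h, mask h x)) (play M E \<pi> cs (\<lambda>s. entry (x s)) t)) (?W y)" for x y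
  proof -
    have *: "play M E \<pi> cs (\<lambda>s. entry ((x(t := y)) s)) t = play M E \<pi> cs (\<lambda>s. entry (x s)) t"
      by (rule play_cong[where B = UNIV]) auto
    show ?thesis
      unfolding play.simps * map_bind_pmf bind_map_pmf
    proof (rule bind_pmf_cong[OF refl])
      fix h assume "h \<in> set_pmf (play M E \<pi> cs (\<lambda>s. entry (x s)) t)"
      then have len: "length h = t" by (rule length_play)
      have r: "restrict (\<lambda>(s, c, a). entry ((x(t := y)) s) (c, a)) (observed M E h) =
          restrict (\<lambda>(s, c, a). entry (mask h x s) (c, a)) (observed M E h)"
        using len by (intro restrict_ext) (auto simp: observed_def mask_def seen_def intro!: entry_cong)
      have m: "mask (h @ [(cs t, a)]) (x(t := y)) = (mask h x)(t := (\<lambda>\<alpha>. \<alpha> \<in> seen a \<and> y \<alpha>))" for a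
        using len by (intro ext) (auto simp: mask_def nth_append)
      show "map_pmf (\<lambda>h. (h, mask h (x(t := y)))) (map_pmf (\<lambda>a. h @ [(cs t, a)])
            (\<pi> h (restrict (\<lambda>(s, c, a). entry ((x(t := y)) s) (c, a)) (observed M E h)) (cs t))) =
          (case (h, mask h x) of (h, x) \<Rightarrow> bind_pmf (choice t h x)
            (\<lambda>a. return_pmf (h @ [(cs t, a)], x(t := (\<lambda>\<alpha>. \<alpha> \<in> seen a \<and> y \<alpha>)))))"
        unfolding r by (simp add: choice_def map_pmf_comp o_def m map_pmf_def[symmetric])
    qed
  qed
  have "Pi_pmf {..<Suc t} (\<lambda>_. False) (\<lambda>_. bits p A) =
      bind_pmf (bits p A) (\<lambda>y. bind_pmf ?P (\<lambda>x. return_pmf (x(t := y))))"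
    unfolding lessThan_Suc by (rule Pi_pmf_insert') auto
  then have "bind_pmf (Pi_pmf {..<Suc t} (\<lambda>_. False) (\<lambda>_. bits p A)) (\<lambda>x.
     map_pmf (\<lambda>h. (h, mask h x)) (play M E \<pi> cs (\<lambda>s. entry (x s)) (Suc t))) =
     bind_pmf (bits p A) (\<lambda>y. bind_pmf ?P (\<lambda>x.
       map_pmf (\<lambda>h. (h, mask h (x(t := y)))) (play M E \<pi> cs (\<lambda>s. entry ((x(t := y)) s)) (Suc t))))"
    by (simp add: bind_assoc_pmf bind_return_pmf del: play.simps)
  also have "\<dots> = bind_pmf (bits p A) (\<lambda>y. bind_pmf (run p t) (?W y))"
    unfolding step Suc.IH[symmetric] bind_assoc_pmf ..
  \<comment> \<open>Fresh bits are independent of the past; a second exchange below moves them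
    behind the choice of the action.\<close>
  also have "\<dots> = bind_pmf (run p t) (\<lambda>s. bind_pmf (bits p A) (\<lambda>y. ?W y s))"
    by (rule bind_commute_pmf)
  also have "\<dots> = run p (Suc t)"
    unfolding run.simps
  proof (rule bind_pmf_cong[OF refl])
    fix s :: "history \<times> (nat \<Rightarrow> nat \<Rightarrow> bool)"
    obtain h x where s: "s = (h, x)" by force
    have "bind_pmf (bits p A) (\<lambda>y. ?W y s) = bind_pmf (choice t h x) (\<lambda>a. bind_pmf (bits p A)
        (\<lambda>y. return_pmf (h @ [(cs t, a)], x(t := (\<lambda>\<alpha>. \<alpha> \<in> seen a \<and> y \<alpha>)))))"
      unfolding s by (simp, rule bind_commute_pmf)
    also have "\<dots> = bind_pmf (choice t h x) (\<lambda>a. map_pmf (\<lambda>y. (h @ [(cs t, a)], x(t := y))) (bits p (seen a)))"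
      unfolding bits_seen[symmetric] by (simp add: map_pmf_comp o_def map_pmf_def[symmetric])
    finally show "bind_pmf (bits p A) (\<lambda>y. ?W y s) = (case s of (h, x) \<Rightarrow> bind_pmf (choice t h x) (\<lambda>a.
       map_pmf (\<lambda>y. (h @ [(cs t, a)], x(t := y))) (bits p (seen a))))" by (simp add: s)
  qed
  finally show ?case .
qed

definition hist :: "(nat \<Rightarrow> real) \<Rightarrow> nat \<Rightarrow> history pmf" where
  "hist p t = map_pmf fst (run p t)"

lemma hist_eq_play:
  "hist p t = bind_pmf (Pi_pmf {..<t} (\<lambda>_. False) (\<lambda>_. bits p A)) (\<lambda>x. play M E \<pi> cs (\<lambda>s. entry (x s)) t)"
  unfolding hist_def run_eq_play[symmetric] by (simp add: map_bind_pmf map_pmf_comp o_def)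

lemma set_pmf_hist:
  assumes "h \<in> set_pmf (hist p t)"
  shows "length h = t" "s < t \<Longrightarrow> fst (h ! s) = cs s \<and> snd (h ! s) \<in> {1..K}"
proof -
  from assms obtain r where "h \<in> set_pmf (play M E \<pi> cs r t)" by (auto simp: hist_eq_play)
  then show "length h = t" "s < t \<Longrightarrow> fst (h ! s) = cs s \<and> snd (h ! s) \<in> {1..K}"
    using set_pmf_play[OF policy] by blast+
qed

text \<open>Later rounds only append to the history, so truncation forgets them.\<close>

lemma map_take_hist: "t \<le> t' \<Longrightarrow> map_pmf (take t) (hist p t') = hist p t"
proof (induction t' rule: dec_induct)
  case base
  have "map_pmf (take t) (hist p t) = map_pmf id (hist p t)"
    by (rule map_pmf_cong[OF refl]) (simp add: set_pmf_hist)
  then show ?case by simp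
next
  case (step n)
  have "map_pmf (take t) (hist p (Suc n)) = bind_pmf (run p n) (\<lambda>s. return_pmf (take t (fst s)))"
    unfolding hist_def run.simps map_bind_pmf
  proof (rule bind_pmf_cong[OF refl])
    fix s assume s: "s \<in> set_pmf (run p n)"
    obtain h x where hx: "s = (h, x)" by force
    have "h \<in> set_pmf (hist p n)" using s by (force simp: hist_def hx)
    then have "length h = n" by (rule set_pmf_hist)
    with step show "map_pmf (take t) (map_pmf fst (case s of (h, x) \<Rightarrow> bind_pmf (choice n h x) (\<lambda>a.
        map_pmf (\<lambda>y. (h @ [(cs n, a)], x(n := y))) (bits p (seen a))))) = return_pmf (take t (fst s))"
      by (simp add: hx map_bind_pmf map_pmf_comp o_def)
  qed
  also have "\<dots> = map_pmf (take t) (hist p n)"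
    unfolding hist_def by (simp add: map_pmf_def bind_assoc_pmf bind_return_pmf)
  finally show ?case using step.IH by simp
qed

lemma rounds_regret_bounded: "\<exists>B. \<forall>h. \<bar>rounds_regret K T cs (mean p) h\<bar> \<le> B"
proof -
  define C where "C = (\<Sum>a\<in>A. \<bar>p a\<bar>) + 1"
  have m: "\<bar>mean p c a\<bar> \<le> C" for c a
    using member_le_sum[of a A "\<lambda>a. \<bar>p a\<bar>"] finite_A sum_nonneg[of A "\<lambda>a. \<bar>p a\<bar>"]
    by (auto simp: mean_def C_def)
  have "\<bar>rounds_regret K T cs (mean p) h\<bar> \<le> (\<Sum>t<T. \<bar>Max (mean p (cs t) ` {1..K})\<bar> + C)" for h
    unfolding rounds_regret_def
    by (rule order_trans[OF sum_abs]) (auto intro!: sum_mono order_trans[OF abs_triangle_ineq4] m)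
  then show ?thesis by blast
qed

lemma expected_regret_hist:
  "expected_regret K M T E \<pi> cs (mean p) (\<lambda>_. reward_law p) =
    measure_pmf.expectation (hist p T) (rounds_regret K T cs (mean p))"
proof -
  obtain B where B: "\<And>h. \<bar>rounds_regret K T cs (mean p) h\<bar> \<le> B" using rounds_regret_bounded by blast
  show ?thesis
    unfolding hist_eq_play reward_law_def
    by (subst expected_regret_pmf[OF policy E_sub]) (rule expectation_bind_pmf[OF B, symmetric])
qed

section \<open>Observation counts and divergence\<close>

definition views :: "nat \<Rightarrow> nat \<Rightarrow> history \<Rightarrow> real" where
  "views \<alpha> t h = (\<Sum>s<t. of_bool ((snd (h ! s), \<alpha>) \<in> E))"

lemma views_bounds: "0 \<le> views \<alpha> t h" "views \<alpha> t h \<le> t"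
proof -
  show "0 \<le> views \<alpha> t h" unfolding views_def by (intro sum_nonneg) auto
  have "views \<alpha> t h \<le> (\<Sum>s<t. 1)" unfolding views_def by (intro sum_mono) auto
  then show "views \<alpha> t h \<le> t" by simp
qed

text \<open>The increment is the probability that the next choice observes \<alpha>, the form in
  which the chain rule produces it.\<close>

lemma expectation_views_Suc:
  "measure_pmf.expectation (run p (Suc t)) (\<lambda>s. views \<alpha> (Suc t) (fst s)) =
   measure_pmf.expectation (run p t) (\<lambda>s. views \<alpha> t (fst s)) +
   measure_pmf.expectation (run p t) (\<lambda>(h, x). measure_pmf.expectation (choice t h x) (\<lambda>a. of_bool ((a, \<alpha>) \<in> E)))"
proof -
  let ?e = "\<lambda>(h, x). measure_pmf.expectation (choice t h x) (\<lambda>a. of_bool ((a, \<alpha>) \<in> E)) :: real"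
  let ?k = "\<lambda>(h, x). bind_pmf (choice t h x) (\<lambda>a.
     map_pmf (\<lambda>y. (h @ [(cs t, a)], x(t := y))) (bits p (seen a)))"
  have e: "\<bar>?e s\<bar> \<le> 1" for s
    using expectation_pmf_bounds[of 0 "\<lambda>a. of_bool ((a, \<alpha>) \<in> E)" "1::real" "choice t (fst s) (snd s)"]
    by (auto simp: case_prod_unfold)
  have v: "\<bar>views \<alpha> t h\<bar> \<le> t" for h t using views_bounds[of \<alpha> t h] by auto
  have "measure_pmf.expectation (run p (Suc t)) (\<lambda>s. views \<alpha> (Suc t) (fst s)) =
      measure_pmf.expectation (run p t) (\<lambda>s. measure_pmf.expectation (?k s) (\<lambda>s. views \<alpha> (Suc t) (fst s)))"
    unfolding run.simps by (rule expectation_bind_pmf) (rule v)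
  also have "\<dots> = measure_pmf.expectation (run p t) (\<lambda>s. views \<alpha> t (fst s) + ?e s)"
  proof (rule expectation_pmf_cong)
    fix s assume s: "s \<in> set_pmf (run p t)"
    obtain h x where hx: "s = (h, x)" by force
    have "h \<in> set_pmf (hist p t)" using s by (force simp: hist_def hx)
    then have len: "length h = t" by (rule set_pmf_hist)
    have "measure_pmf.expectation (?k s) (\<lambda>s. views \<alpha> (Suc t) (fst s)) =
        measure_pmf.expectation (choice t h x) (\<lambda>a. views \<alpha> (Suc t) (h @ [(cs t, a)]))"
      unfolding hx by (simp, subst expectation_bind_pmf[where B = "Suc t"]) (use v[of "Suc t"] in auto)
    also have "\<dots> = measure_pmf.expectation (choice t h x) (\<lambda>a. views \<alpha> t h + of_bool ((a, \<alpha>) \<in> E))"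
    proof -
      have "views \<alpha> (Suc t) (h @ [(cs t, a)]) = views \<alpha> t h + of_bool ((a, \<alpha>) \<in> E)" for a
        using len by (simp add: views_def nth_append)
      then show ?thesis by simp
    qed
    also have "\<dots> = views \<alpha> t h + ?e (h, x)"
      by (subst Bochner_Integration.integral_add) (auto intro: integrable_pmf_bounded[where B = 1])
    finally show "measure_pmf.expectation (?k s) (\<lambda>s. views \<alpha> (Suc t) (fst s)) = views \<alpha> t (fst s) + ?e s"
      by (simp add: hx)
  qed
  also have "\<dots> = measure_pmf.expectation (run p t) (\<lambda>s. views \<alpha> t (fst s)) + measure_pmf.expectation (run p t) ?e"
    by (rule Bochner_Integration.integral_add[OF integrable_pmf_bounded[OF v] integrable_pmf_bounded[OF e]])
  finally show ?thesis .
qed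

text \<open>Divergence decomposition: the policy is the same under both parameters, so only a round
  that observes \<alpha> costs divergence, at most \<open>d\<close> each time.\<close>

lemma kl_le_run:
  assumes d: "0 \<le> d" "kl_le (bernoulli_pmf (p \<alpha>)) (bernoulli_pmf (q \<alpha>)) d"
    and eq: "\<And>a. a \<noteq> \<alpha> \<Longrightarrow> p a = q a" and "\<alpha> \<in> A"
  shows "kl_le (run p t) (run q t) (d * measure_pmf.expectation (run p t) (\<lambda>s. views \<alpha> t (fst s)))"
proof (induction t)
  case 0
  then show ?case using kl_le_refl by (simp add: views_def)
next
  case (Suc t)
  let ?e = "\<lambda>(h, x). measure_pmf.expectation (choice t h x) (\<lambda>a. of_bool ((a, \<alpha>) \<in> E)) :: real"
  have e: "\<bar>?e s\<bar> \<le> 1" for s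
    using expectation_pmf_bounds[of 0 "\<lambda>a. of_bool ((a, \<alpha>) \<in> E)" "1::real" "choice t (fst s) (snd s)"]
    by (auto simp: case_prod_unfold)
  have bits: "kl_le (bits p (seen a)) (bits q (seen a)) (d * of_bool ((a, \<alpha>) \<in> E))" for a
  proof (cases "(a, \<alpha>) \<in> E")
    case True
    have "finite (seen a)" using finite_A by (simp add: seen_def)
    then have "kl_le (bits p (seen a)) (bits q (seen a)) d"
      unfolding bits_def using True \<open>\<alpha> \<in> A\<close> d eq
      by (intro kl_le_Pi_pmf_coordinate[where \<alpha> = \<alpha>]) (auto simp: seen_def)
    then show ?thesis using True by simp
  next
    case False
    have "bits p (seen a) = bits q (seen a)"
      unfolding bits_def
    proof (rule Pi_pmf_cong)
      fix x assume "x \<in> seen a"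
      with False have "x \<noteq> \<alpha>" by (auto simp: seen_def)
      then show "bernoulli_pmf (p x) = bernoulli_pmf (q x)" by (simp add: eq)
    qed auto
    then show ?thesis using False kl_le_refl by simp
  qed
  have step: "kl_le
     (case s of (h, x) \<Rightarrow> bind_pmf (choice t h x) (\<lambda>a. map_pmf (\<lambda>y. (h @ [(cs t, a)], x(t := y))) (bits p (seen a))))
     (case s of (h, x) \<Rightarrow> bind_pmf (choice t h x) (\<lambda>a. map_pmf (\<lambda>y. (h @ [(cs t, a)], x(t := y))) (bits q (seen a))))
     (d * ?e s)" for s
  proof -
    obtain h x where hx: "s = (h, x)" by force
    have "kl_le
     (bind_pmf (choice t h x) (\<lambda>a. map_pmf (\<lambda>y. (h @ [(cs t, a)], x(t := y))) (bits p (seen a))))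
     (bind_pmf (choice t h x) (\<lambda>a. map_pmf (\<lambda>y. (h @ [(cs t, a)], x(t := y))) (bits q (seen a))))
     (0 + measure_pmf.expectation (choice t h x) (\<lambda>a. d * of_bool ((a, \<alpha>) \<in> E)))"
      by (rule kl_le_bind[where B = d, OF kl_le_refl kl_le_map[OF bits]]) (use d in auto)
    then show ?thesis by (simp add: hx)
  qed
  have "kl_le (run p (Suc t)) (run q (Suc t))
    (d * measure_pmf.expectation (run p t) (\<lambda>s. views \<alpha> t (fst s)) + measure_pmf.expectation (run p t) (\<lambda>s. d * ?e s))"
    unfolding run.simps
    by (rule kl_le_bind[where B = d, OF Suc.IH step]) (use d mult_left_mono[OF e, of d] in \<open>auto simp: abs_mult\<close>)
  then show ?case unfolding expectation_views_Suc by (simp add: distrib_left)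
qed

text \<open>\<open>g\<close> is a randomized test between a bad and a good arm \<alpha>; if \<alpha>
  is rarely seen under the bad-arm law, the two errors cannot both be small.\<close>

lemma testing_lower_bound:
  assumes \<epsilon>: "0 \<le> \<epsilon>" "\<epsilon> \<le> 1/4"
    and p: "p \<alpha> = 1/2 - \<epsilon>" and q: "q = p(\<alpha> := 1/2 + \<epsilon>)" and "\<alpha> \<in> A"
    and g: "\<And>h. 0 \<le> g h" "\<And>h. g h \<le> 1"
  shows "measure_pmf.expectation (hist q t) g + measure_pmf.expectation (hist p t) (\<lambda>h. 1 - g h)
     \<ge> ln 2 - 16 * \<epsilon>\<^sup>2 * measure_pmf.expectation (hist p t) (views \<alpha> t)"
proof -
  have "kl_le (run p t) (run q t) (16 * \<epsilon>\<^sup>2 * measure_pmf.expectation (run p t) (\<lambda>s. views \<alpha> t (fst s)))"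
    by (rule kl_le_run) (use assms bernoulli_divergence_le[OF \<epsilon>] in auto)
  then have "kl_le (hist p t) (hist q t) (16 * \<epsilon>\<^sup>2 * measure_pmf.expectation (hist p t) (views \<alpha> t))"
    unfolding hist_def by (auto intro: kl_le_map)
  then show ?thesis by (rule kl_le_two_point) (use g in auto)
qed

end

section \<open>Averaging over the good actions\<close>

text \<open>Rounds of \<open>B c\<close> form the block of context \<open>c\<close>, which ends before round \<open>en c\<close>. The alternative
  \<open>arms (ctx \<alpha>) = {\<alpha>}\<close> in the last assumption admits full feedback when a block has a single
  unknown arm: \<open>n\<close> observations of it are then harmless, since \<open>card (B c) = n\<close>.\<close>

locale block_bandit = bernoulli_bandit K M E \<pi> cs A b ctx
  for K M :: nat and E \<pi> cs A b ctx +
  fixes T n :: nat and B :: "nat \<Rightarrow> nat set" and en :: "nat \<Rightarrow> nat"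
  assumes n: "n \<ge> 1"
    and block: "c \<in> {1..M} \<Longrightarrow> t \<in> B c \<Longrightarrow> cs t = c \<and> t < en c"
    and en_le: "c \<in> {1..M} \<Longrightarrow> en c \<le> T"
    and card_block: "c \<in> {1..M} \<Longrightarrow> card (B c) = n * card (arms c)"
    and reveal: "\<alpha> \<in> A \<Longrightarrow> t < en (ctx \<alpha>) \<Longrightarrow> (a, \<alpha>) \<in> E \<Longrightarrow> a \<in> insert b (arms (cs t)) \<Longrightarrow>
       t \<in> B (ctx \<alpha>) \<and> (a = \<alpha> \<or> arms (ctx \<alpha>) = {\<alpha>})"
begin

text \<open>The constant makes the divergence bound \<open>16 * gap\<^sup>2\<close> of one
  observation equal to \<open>1 / (16 * n)\<close>, so \<open>n\<close> observations cost only
  1/16.\<close>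

definition gap :: real where "gap = 1 / (16 * sqrt n)"

lemma gap_pos: "gap > 0" and gap_le: "gap \<le> 1/16" and gap_sq: "16 * gap\<^sup>2 = 1 / (16 * n)"
proof -
  have "sqrt n \<ge> 1" using n by simp
  then show "gap > 0" "gap \<le> 1/16" by (simp_all add: gap_def field_simps)
  show "16 * gap\<^sup>2 = 1 / (16 * n)" using n by (simp add: gap_def power_divide power_mult_distrib)
qed

lemma finite_block: "c \<in> {1..M} \<Longrightarrow> finite (B c)"
  using block by (intro finite_subset[of "B c" "{..<en c}"]) auto

text \<open>\<open>\<theta> c\<close> names the good arm of context \<open>c\<close>; the value
  \<open>b\<close> means that there is none, so that \<open>b\<close> is optimal.\<close>

definition prob_of :: "(nat \<Rightarrow> nat) \<Rightarrow> nat \<Rightarrow> real" where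
  "prob_of \<theta> a = (if a \<in> A \<and> \<theta> (ctx a) = a then 1/2 + gap else 1/2 - gap)"

definition valid :: "(nat \<Rightarrow> nat) \<Rightarrow> bool" where
  "valid \<theta> \<longleftrightarrow> (\<forall>c\<in>{1..M}. \<theta> c \<in> insert b (arms c))"

text \<open>The error in deciding whether \<open>b\<close> is optimal in context \<open>c\<close>,
  where playing any other action counts as the answer no. Confusing two arms other than
  \<open>b\<close> is not charged.\<close>

definition wrong :: "(nat \<Rightarrow> nat) \<Rightarrow> nat \<Rightarrow> nat \<Rightarrow> real" where
  "wrong \<theta> c a = of_bool ((\<theta> c = b) = (a \<noteq> b))"

text \<open>Exotic actions are worth 0 in the current context, but a single play may reveal many
  arms.\<close>

definition exotic :: "nat \<Rightarrow> nat \<Rightarrow> real" where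
  "exotic c a = of_bool (a \<notin> insert b (arms c))"

definition total :: "(nat \<Rightarrow> nat) \<Rightarrow> real" where
  "total \<theta> = measure_pmf.expectation (hist (prob_of \<theta>) T) (rounds_regret K T cs (mean (prob_of \<theta>)))"

definition block_loss :: "nat \<Rightarrow> (nat \<Rightarrow> nat) \<Rightarrow> real" where
  "block_loss c \<theta> = gap * measure_pmf.expectation (hist (prob_of \<theta>) T)
     (\<lambda>h. \<Sum>t\<in>B c. wrong \<theta> c (snd (h ! t)))"

definition exotic_plays :: "(nat \<Rightarrow> nat) \<Rightarrow> real" where
  "exotic_plays \<theta> = measure_pmf.expectation (hist (prob_of \<theta>) T) (\<lambda>h. \<Sum>t<T. exotic (cs t) (snd (h ! t)))"

section \<open>Losses per round and per block\<close>

lemma mean_le_Max: "a \<in> {1..K} \<Longrightarrow> mean p c a \<le> Max (mean p c ` {1..K})"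
  by (intro Max_ge) auto

lemma Max_mean_ge_half: "1/2 \<le> Max (mean p c ` {1..K})"
  using mean_le_Max[of b p c] b_in b_notin by (simp add: mean_def)

text \<open>An exotic action pays 0 while \<open>b\<close> pays 1/2, whence the factor 2.\<close>

lemma loss_ge_exotic:
  assumes "a \<in> {1..K}"
  shows "exotic c a \<le> 2 * (Max (mean p c ` {1..K}) - mean p c a)"
proof -
  define m where "m = Max (mean p c ` {1..K})"
  have "mean p c a \<le> m" "1/2 \<le> m"
    using mean_le_Max[OF assms] Max_mean_ge_half unfolding m_def by auto
  then show ?thesis unfolding m_def[symmetric] by (auto simp: exotic_def mean_def arms_iff)
qed

text \<open>If \<open>b\<close> is optimal, every other action pays at most
  \<open>1/2 - gap\<close>; otherwise \<open>b\<close> falls short of the good arm by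
  \<open>gap\<close>.\<close>

lemma loss_ge_wrong:
  assumes "valid \<theta>" "c \<in> {1..M}" "a \<in> {1..K}"
  shows "gap * wrong \<theta> c a \<le> Max (mean (prob_of \<theta>) c ` {1..K}) - mean (prob_of \<theta>) c a"
proof (cases "(\<theta> c = b) = (a \<noteq> b)")
  case False
  then show ?thesis using mean_le_Max[OF assms(3)] by (simp add: wrong_def)
next
  case True
  then have w: "wrong \<theta> c a = 1" by (simp add: wrong_def)
  show ?thesis
  proof (cases "\<theta> c = b")
    case True
    with \<open>_ = (a \<noteq> b)\<close> have "a \<noteq> b" by simp
    then have "mean (prob_of \<theta>) c a \<le> 1/2 - gap"
      using True gap_le by (auto simp: mean_def prob_of_def)
    then show ?thesis using Max_mean_ge_half[of "prob_of \<theta>" c] w by simp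
  next
    case False
    then have *: "\<theta> c \<in> A" "ctx (\<theta> c) = c" using assms by (auto simp: valid_def arms_iff)
    then have "mean (prob_of \<theta>) c (\<theta> c) = 1/2 + gap" by (simp add: mean_def prob_of_def)
    moreover have "mean (prob_of \<theta>) c (\<theta> c) \<le> Max (mean (prob_of \<theta>) c ` {1..K})"
      using * A_sub by (intro mean_le_Max) auto
    moreover have "a = b" using False \<open>_ = (a \<noteq> b)\<close> by simp
    ultimately show ?thesis using w b_notin by (simp add: mean_def)
  qed
qed

lemma exotic_plays_le: "exotic_plays \<theta> \<le> 2 * total \<theta>"
proof -
  let ?r = "rounds_regret K T cs (mean (prob_of \<theta>))"
  obtain C where C: "\<And>h. \<bar>?r h\<bar> \<le> C" using rounds_regret_bounded by blast
  have "exotic_plays \<theta> \<le> measure_pmf.expectation (hist (prob_of \<theta>) T) (\<lambda>h. 2 * ?r h)"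
    unfolding exotic_plays_def
  proof (rule expectation_pmf_mono[where B = "real T + 2 * C"])
    fix h :: history
    have "(\<Sum>t<T. exotic (cs t) (snd (h ! t))) \<in> {0..T}"
      using sum_bounded_above[of "{..<T}" "\<lambda>t. exotic (cs t) (snd (h ! t))" 1]
      by (auto simp: exotic_def intro!: sum_nonneg)
    then show "\<bar>\<Sum>t<T. exotic (cs t) (snd (h ! t))\<bar> \<le> real T + 2 * C" "\<bar>2 * ?r h\<bar> \<le> real T + 2 * C"
      using C[of h] by auto
    assume "h \<in> set_pmf (hist (prob_of \<theta>) T)"
    then show "(\<Sum>t<T. exotic (cs t) (snd (h ! t))) \<le> 2 * ?r h"
      unfolding rounds_regret_def sum_distrib_left
      by (intro sum_mono loss_ge_exotic) (use set_pmf_hist(2) in auto)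
  qed
  also have "\<dots> = 2 * total \<theta>" by (simp add: total_def)
  finally show ?thesis .
qed

lemma sum_wrong_bounds:
  "0 \<le> (\<Sum>t\<in>S. wrong \<theta> c (snd (h ! t)))" "(\<Sum>t\<in>S. wrong \<theta> c (snd (h ! t))) \<le> card S"
  using sum_bounded_above[of S "\<lambda>t. wrong \<theta> c (snd (h ! t))" 1]
  by (auto simp: wrong_def intro!: sum_nonneg)

text \<open>Blocks are disjoint, since their rounds carry different contexts, and rounds outside all
  blocks lose a nonnegative amount.\<close>

lemma sum_block_loss_le:
  assumes "valid \<theta>"
  shows "(\<Sum>c=1..M. block_loss c \<theta>) \<le> total \<theta>"
proof -
  let ?r = "rounds_regret K T cs (mean (prob_of \<theta>))"
  let ?w = "\<lambda>c (h :: history). gap * (\<Sum>t\<in>B c. wrong \<theta> c (snd (h ! t)))"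
  obtain C where C: "\<And>h. \<bar>?r h\<bar> \<le> C" using rounds_regret_bounded by blast
  have w: "\<bar>?w c h\<bar> \<le> gap * card (B c)" for c h
    using sum_wrong_bounds[of \<theta> c h "B c"] gap_pos by (auto simp: abs_mult intro!: mult_left_mono)
  have "(\<Sum>c=1..M. block_loss c \<theta>) =
      (\<Sum>c=1..M. measure_pmf.expectation (hist (prob_of \<theta>) T) (?w c))"
    by (simp add: block_loss_def)
  also have "\<dots> = measure_pmf.expectation (hist (prob_of \<theta>) T) (\<lambda>h. \<Sum>c=1..M. ?w c h)"
    by (rule Bochner_Integration.integral_sum[symmetric]) (rule integrable_pmf_bounded[OF w])
  also have "\<dots> \<le> total \<theta>"
    unfolding total_def
  proof (rule expectation_pmf_mono[where B = "(\<Sum>c=1..M. gap * card (B c)) + C"])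
    fix h
    have "\<bar>\<Sum>c=1..M. ?w c h\<bar> \<le> (\<Sum>c=1..M. gap * card (B c))"
      by (rule order_trans[OF sum_abs sum_mono[OF w]])
    moreover have "0 \<le> (\<Sum>c=1..M. gap * card (B c))"
      using gap_pos by (intro sum_nonneg) auto
    ultimately show "\<bar>\<Sum>c=1..M. ?w c h\<bar> \<le> (\<Sum>c=1..M. gap * card (B c)) + C"
      "\<bar>?r h\<bar> \<le> (\<Sum>c=1..M. gap * card (B c)) + C"
      using C[of h] by linarith+
    assume h: "h \<in> set_pmf (hist (prob_of \<theta>) T)"
    let ?l = "\<lambda>t. Max (mean (prob_of \<theta>) (cs t) ` {1..K}) - mean (prob_of \<theta>) (cs t) (snd (h ! t))"
    have "(\<Sum>c=1..M. ?w c h) \<le> (\<Sum>c=1..M. \<Sum>t\<in>B c. ?l t)"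
      unfolding sum_distrib_left
    proof (intro sum_mono)
      fix c t assume ct: "c \<in> {1..M}" "t \<in> B c"
      then have t: "cs t = c" "t < T" using block[OF ct] en_le[OF ct(1)] by linarith+
      then show "gap * wrong \<theta> c (snd (h ! t)) \<le> ?l t"
        using loss_ge_wrong[OF assms ct(1), of "snd (h ! t)"] set_pmf_hist(2)[OF h t(2)] by simp
    qed
    also have "\<dots> = (\<Sum>t\<in>(\<Union>c\<in>{1..M}. B c). ?l t)"
    proof (rule sum.UNION_disjoint[symmetric])
      show "\<forall>c\<in>{1..M}. finite (B c)" using finite_block by blast
      have "c = c'" if "c \<in> {1..M}" "c' \<in> {1..M}" "t \<in> B c" "t \<in> B c'" for c c' t
        using block[OF that(1,3)] block[OF that(2,4)] by simp
      then show "\<forall>c\<in>{1..M}. \<forall>c'\<in>{1..M}. c \<noteq> c' \<longrightarrow> B c \<inter> B c' = {}" by blast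
    qed simp
    also have "\<dots> \<le> (\<Sum>t<T. ?l t)"
    proof (rule sum_mono2)
      have "t < T" if "c \<in> {1..M}" "t \<in> B c" for c t
        using block[OF that] en_le[OF that(1)] by linarith
      then show "(\<Union>c\<in>{1..M}. B c) \<subseteq> {..<T}" by blast
      show "0 \<le> ?l t" if "t \<in> {..<T} - (\<Union>c\<in>{1..M}. B c)" for t
        using mean_le_Max[of "snd (h ! t)"] set_pmf_hist(2)[OF h, of t] that by simp
    qed simp
    finally show "(\<Sum>c=1..M. ?w c h) \<le> ?r h" by (simp add: rounds_regret_def)
  qed
  finally show ?thesis .
qed

text \<open>The testing argument stops at \<open>en c\<close>, up to which \<open>reveal\<close>
  controls the observations, while losses are measured over \<open>T\<close> rounds. Writing
  \<open>undefined\<close> beyond the cut expresses that \<open>f\<close> sees no later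
  round.\<close>

lemma hist_prefix:
  assumes "c \<in> {1..M}"
  shows "measure_pmf.expectation (hist p (en c)) (\<lambda>h. f (\<lambda>t. if t < en c then h ! t else undefined)) =
    measure_pmf.expectation (hist p T) (\<lambda>h. f (\<lambda>t. if t < en c then h ! t else undefined) :: real)"
proof -
  have "(\<lambda>t. if t < en c then take (en c) h ! t else undefined) = (\<lambda>t. if t < en c then h ! t else undefined)"
    for h :: history by auto
  then show ?thesis
    unfolding map_take_hist[OF en_le[OF assms], symmetric] integral_map_pmf by simp
qed

text \<open>By \<open>reveal\<close>, a non-exotic play before \<open>en c\<close> shows an arm of
  context \<open>c\<close> only inside \<open>B c\<close>, and then at most one of them; an exotic
  play shows at most all \<open>card (arms c)\<close>.\<close>

lemma sum_views_le:
  assumes c: "c \<in> {1..M}" and h: "h \<in> set_pmf (hist p T)"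
  shows "(\<Sum>\<alpha>\<in>arms c. views \<alpha> (en c) h) \<le>
    real (n * card (arms c)) + card (arms c) * (\<Sum>t<T. exotic (cs t) (snd (h ! t)))"
proof -
  let ?a = "\<lambda>t. snd (h ! t)"
  let ?V = "\<lambda>\<alpha> t. of_bool (t \<in> B c \<and> (?a t = \<alpha> \<or> arms c = {\<alpha>})) :: real"
  have V: "of_bool ((?a t, \<alpha>) \<in> E) \<le> ?V \<alpha> t + exotic (cs t) (?a t)" if "\<alpha> \<in> arms c" "t < en c" for \<alpha> t
    using reveal[of \<alpha> t "?a t"] that by (auto simp: exotic_def arms_iff)
  have V1: "(\<Sum>\<alpha>\<in>arms c. ?V \<alpha> t) \<le> of_bool (t \<in> B c)" for t
  proof (cases "\<exists>\<alpha>. arms c = {\<alpha>}")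
    case False
    then have "(\<Sum>\<alpha>\<in>arms c. ?V \<alpha> t) = (\<Sum>\<alpha>\<in>arms c. if \<alpha> = ?a t then of_bool (t \<in> B c) else 0)"
      by (intro sum.cong) auto
    also have "\<dots> \<le> of_bool (t \<in> B c)" using finite_arms by (simp add: sum.delta)
    finally show ?thesis .
  qed auto
  have "(\<Sum>\<alpha>\<in>arms c. views \<alpha> (en c) h) \<le> (\<Sum>\<alpha>\<in>arms c. \<Sum>t<en c. ?V \<alpha> t + exotic (cs t) (?a t))"
    unfolding views_def by (intro sum_mono V) auto
  also have "\<dots> = (\<Sum>t<en c. \<Sum>\<alpha>\<in>arms c. ?V \<alpha> t) + card (arms c) * (\<Sum>t<en c. exotic (cs t) (?a t))"
    by (simp add: sum.distrib sum.swap[of _ "arms c" "{..<en c}"] sum_distrib_left)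
  also have "(\<Sum>t<en c. \<Sum>\<alpha>\<in>arms c. ?V \<alpha> t) \<le> (\<Sum>t<en c. of_bool (t \<in> B c))"
    by (intro sum_mono V1)
  also have "(\<Sum>t<en c. of_bool (t \<in> B c)) = real (n * card (arms c))"
  proof -
    have "{..<en c} \<inter> {t. t \<in> B c} = B c" using block[OF c] by auto
    then have "(\<Sum>t<en c. of_bool (t \<in> B c)) = real (card (B c))" by (simp add: sum.If_cases of_bool_def)
    then show ?thesis using card_block[OF c] by simp
  qed
  also have "(\<Sum>t<en c. exotic (cs t) (?a t)) \<le> (\<Sum>t<T. exotic (cs t) (?a t))"
    using en_le[OF c] by (intro sum_mono2) (auto simp: exotic_def)
  finally show ?thesis by (simp add: mult_left_mono)
qed

text \<open>With the other contexts fixed, the case that \<open>b\<close> is optimal is tested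
  against each single good arm. On average over the arms an arm is seen at most
  \<open>3/2 * n\<close> times, so the divergence stays below a small constant.\<close>

lemma block_loss_pair:
  assumes c: "c \<in> {1..M}" and ne: "arms c \<noteq> {}"
    and val: "valid (\<theta>(c := b))" and small: "total (\<theta>(c := b)) \<le> n / 4"
  shows "block_loss c (\<theta>(c := b)) + (\<Sum>\<alpha>\<in>arms c. block_loss c (\<theta>(c := \<alpha>))) / card (arms c)
     \<ge> gap * n * card (arms c) / 2"
proof -
  define m where "m = card (arms c)"
  have m: "m > 0" using ne finite_arms by (simp add: m_def card_gt_0_iff)
  define L where "L = real (n * m)"
  have L: "L > 0" using m n by (simp add: L_def)
  define p where "p = prob_of (\<theta>(c := b))"
  \<comment> \<open>\<open>g\<close> is the fraction of the block in which \<open>b\<close> is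
    played. Its mean under a good arm, and the mean of \<open>1 - g\<close> when \<open>b\<close> is
    optimal, are the normalized block losses.\<close>
  define g where "g h = (\<Sum>t\<in>B c. of_bool (snd (h ! t) = b)) / L" for h :: history
  have cardB: "real (card (B c)) = L" using card_block[OF c] by (simp add: L_def m_def)
  have g01: "0 \<le> g h" "g h \<le> 1" for h
    using sum_bounded_above[of "B c" "\<lambda>t. of_bool (snd (h ! t) = b)" "1::real"] L cardB
    by (auto simp: g_def intro!: sum_nonneg divide_nonneg_pos)
  have g': "1 - g h = (\<Sum>t\<in>B c. of_bool (snd (h ! t) \<noteq> b)) / L" for h
  proof -
    have "(\<Sum>t\<in>B c. of_bool (snd (h ! t) \<noteq> b)) + (\<Sum>t\<in>B c. of_bool (snd (h ! t) = b)) = (\<Sum>t\<in>B c. (1::real))"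
      unfolding sum.distrib[symmetric] by (intro sum.cong) auto
    then show ?thesis using L cardB by (simp add: g_def field_simps)
  qed
  have pre: "measure_pmf.expectation (hist r (en c)) (\<lambda>h. \<Sum>t\<in>B c. F (snd (h ! t))) =
      measure_pmf.expectation (hist r T) (\<lambda>h. \<Sum>t\<in>B c. F (snd (h ! t)))" for r and F :: "nat \<Rightarrow> real"
  proof -
    have "(\<Sum>t\<in>B c. F (snd (h ! t))) = (\<Sum>t\<in>B c. F (snd (if t < en c then h ! t else undefined)))" for h :: history
      using block[OF c] by (intro sum.cong) auto
    then show ?thesis using hist_prefix[OF c, of r "\<lambda>u. \<Sum>t\<in>B c. F (snd (u t))"] by simp
  qed
  have Eb: "measure_pmf.expectation (hist p (en c)) (\<lambda>h. 1 - g h) = block_loss c (\<theta>(c := b)) / (gap * L)"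
  proof -
    have "measure_pmf.expectation (hist p (en c)) (\<lambda>h. 1 - g h) =
       measure_pmf.expectation (hist p (en c)) (\<lambda>h. \<Sum>t\<in>B c. of_bool (snd (h ! t) \<noteq> b)) / L"
      unfolding g' by simp
    then show ?thesis unfolding pre[of p "\<lambda>a. of_bool (a \<noteq> b)"]
      using gap_pos by (simp add: block_loss_def wrong_def p_def)
  qed
  have Ea: "measure_pmf.expectation (hist (prob_of (\<theta>(c := \<alpha>))) (en c)) g = block_loss c (\<theta>(c := \<alpha>)) / (gap * L)"
    if "\<alpha> \<in> arms c" for \<alpha>
  proof -
    have "\<alpha> \<noteq> b" using that b_notin by (auto simp: arms_iff)
    have "measure_pmf.expectation (hist (prob_of (\<theta>(c := \<alpha>))) (en c)) g =
       measure_pmf.expectation (hist (prob_of (\<theta>(c := \<alpha>))) (en c)) (\<lambda>h. \<Sum>t\<in>B c. of_bool (snd (h ! t) = b)) / L"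
      unfolding g_def by simp
    then show ?thesis unfolding pre[of _ "\<lambda>a. of_bool (a = b)"]
      using gap_pos \<open>\<alpha> \<noteq> b\<close> by (simp add: block_loss_def wrong_def)
  qed
  have viewsT: "measure_pmf.expectation (hist p (en c)) (views \<alpha> (en c)) =
      measure_pmf.expectation (hist p T) (views \<alpha> (en c))" for \<alpha>
  proof -
    have "views \<alpha> (en c) = (\<lambda>h. \<Sum>s<en c. of_bool ((snd (if s < en c then h ! s else undefined), \<alpha>) \<in> E))"
      by (intro ext) (simp add: views_def)
    then show ?thesis using hist_prefix[OF c, of p "\<lambda>u. \<Sum>s<en c. of_bool ((snd (u s), \<alpha>) \<in> E)"] by simp
  qed
  define v where "v \<alpha> = measure_pmf.expectation (hist p T) (views \<alpha> (en c))" for \<alpha>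
  have test: "block_loss c (\<theta>(c := \<alpha>)) / (gap * L) + block_loss c (\<theta>(c := b)) / (gap * L)
      \<ge> ln 2 - v \<alpha> / (16 * n)" if \<alpha>: "\<alpha> \<in> arms c" for \<alpha>
  proof -
    have \<alpha>': "\<alpha> \<in> A" "ctx \<alpha> = c" "\<alpha> \<noteq> b" using \<alpha> b_notin by (auto simp: arms_iff)
    have "measure_pmf.expectation (hist (prob_of (\<theta>(c := \<alpha>))) (en c)) g +
        measure_pmf.expectation (hist p (en c)) (\<lambda>h. 1 - g h)
        \<ge> ln 2 - 16 * gap\<^sup>2 * measure_pmf.expectation (hist p (en c)) (views \<alpha> (en c))"
    proof (rule testing_lower_bound[where \<alpha> = \<alpha>])
      show "p \<alpha> = 1/2 - gap" using \<alpha>' by (simp add: p_def prob_of_def)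
      show "prob_of (\<theta>(c := \<alpha>)) = p(\<alpha> := 1/2 + gap)"
      proof
        fix a
        show "prob_of (\<theta>(c := \<alpha>)) a = (p(\<alpha> := 1/2 + gap)) a"
          using \<alpha>' b_notin by (auto simp: p_def prob_of_def)
      qed
    qed (use gap_pos gap_le \<alpha>' g01 in auto)
    then show ?thesis unfolding Ea[OF \<alpha>] Eb viewsT gap_sq v_def by simp
  qed
  \<comment> \<open>The block itself accounts for \<open>n * m\<close> views; exotic plays number at
    most \<open>n / 2\<close> in expectation by \<open>small\<close>, and each counts at most
    \<open>m\<close> times.\<close>
  have sumv: "(\<Sum>\<alpha>\<in>arms c. v \<alpha>) \<le> 3/2 * real (n * m)"
  proof -
    have vb: "\<bar>views \<alpha> (en c) h\<bar> \<le> en c" for \<alpha> h using views_bounds[of \<alpha> "en c" h] by auto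
    let ?N = "\<lambda>h :: history. \<Sum>t<T. exotic (cs t) (snd (h ! t))"
    have N: "\<bar>?N h\<bar> \<le> T" for h
      using sum_bounded_above[of "{..<T}" "\<lambda>t. exotic (cs t) (snd (h ! t))" 1]
      by (auto simp: exotic_def abs_of_nonneg sum_nonneg)
    have "(\<Sum>\<alpha>\<in>arms c. v \<alpha>) = measure_pmf.expectation (hist p T) (\<lambda>h. \<Sum>\<alpha>\<in>arms c. views \<alpha> (en c) h)"
      unfolding v_def
      by (rule Bochner_Integration.integral_sum[symmetric]) (rule integrable_pmf_bounded[OF vb])
    also have "\<dots> \<le> measure_pmf.expectation (hist p T) (\<lambda>h. real (n * m) + m * ?N h)"
    proof (rule expectation_pmf_mono[where B = "real m * en c + real (n * m) + real m * T"])
      fix h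
      have "\<bar>\<Sum>\<alpha>\<in>arms c. views \<alpha> (en c) h\<bar> \<le> (\<Sum>\<alpha>\<in>arms c. real (en c))"
        by (rule order_trans[OF sum_abs sum_mono[OF vb]])
      moreover have "0 \<le> real (n * m) + real m * T" by simp
      ultimately show "\<bar>\<Sum>\<alpha>\<in>arms c. views \<alpha> (en c) h\<bar> \<le> real m * en c + real (n * m) + real m * T"
        unfolding m_def sum_constant by linarith
      have "\<bar>real m * ?N h\<bar> \<le> real m * T" using N[of h] by (simp add: abs_mult mult_left_mono)
      then show "\<bar>real (n * m) + m * ?N h\<bar> \<le> real m * en c + real (n * m) + real m * T"
        using mult_nonneg_nonneg[of "real n" "real m"] mult_nonneg_nonneg[of "real m" "real (en c)"]
        unfolding of_nat_mult by linarith
    qed (use sum_views_le[OF c] in \<open>auto simp: m_def\<close>)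
    also have "\<dots> = real (n * m) + m * exotic_plays (\<theta>(c := b))"
      unfolding exotic_plays_def p_def[symmetric]
      using integrable_pmf_bounded[of ?N T "hist p T", OF N] by simp
    also have "\<dots> \<le> real (n * m) + m * (2 * (n / 4))"
      using exotic_plays_le[of "\<theta>(c := b)"] small by (intro add_left_mono mult_left_mono) auto
    finally show ?thesis by (simp add: algebra_simps)
  qed
  have "(\<Sum>\<alpha>\<in>arms c. ln 2 - v \<alpha> / (16 * n)) \<le> (\<Sum>\<alpha>\<in>arms c. block_loss c (\<theta>(c := \<alpha>)) / (gap * L)
      + block_loss c (\<theta>(c := b)) / (gap * L))"
    by (rule sum_mono[OF test])
  also have "\<dots> = ((\<Sum>\<alpha>\<in>arms c. block_loss c (\<theta>(c := \<alpha>))) + m * block_loss c (\<theta>(c := b))) / (gap * L)"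
    by (simp add: sum.distrib sum_divide_distrib m_def add_divide_distrib)
  finally have up: "(\<Sum>\<alpha>\<in>arms c. ln 2 - v \<alpha> / (16 * n)) \<le> \<dots>" .
  have "(\<Sum>\<alpha>\<in>arms c. ln 2 - v \<alpha> / (16 * n)) = m * ln 2 - (\<Sum>\<alpha>\<in>arms c. v \<alpha>) / (16 * n)"
    by (simp add: sum_subtractf sum_divide_distrib m_def)
  \<comment> \<open>The average divergence is at most 3/32, and \<open>2/3 - 3/32\<close> exceeds
    1/2.\<close>
  also have "\<dots> \<ge> m * (2/3) - 3/2 * real (n * m) / (16 * n)"
    using ln2_ge_two_thirds sumv n by (intro diff_mono mult_left_mono divide_right_mono) auto
  also have "m * (2/3) - 3/2 * real (n * m) / (16 * n) \<ge> m / 2" using n by simp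
  finally have "m / 2 \<le> ((\<Sum>\<alpha>\<in>arms c. block_loss c (\<theta>(c := \<alpha>))) + m * block_loss c (\<theta>(c := b))) / (gap * L)"
    using up by linarith
  then have "m / 2 * (gap * L) \<le> (\<Sum>\<alpha>\<in>arms c. block_loss c (\<theta>(c := \<alpha>))) + m * block_loss c (\<theta>(c := b))"
    using L gap_pos by (simp add: pos_le_divide_eq)
  then have "(m / 2 * (gap * L)) / m \<le> ((\<Sum>\<alpha>\<in>arms c. block_loss c (\<theta>(c := \<alpha>))) + m * block_loss c (\<theta>(c := b))) / m"
    by (intro divide_right_mono) auto
  then show ?thesis using m by (simp add: add_divide_distrib L_def m_def algebra_simps)
qed

text \<open>The fair coin gives the case that \<open>b\<close> is optimal the same weight as all
  good arms together, matching the two terms of \<open>block_loss_pair\<close>.\<close>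

definition prior :: "nat \<Rightarrow> nat pmf" where
  "prior c = (if arms c = {} then return_pmf b
     else bind_pmf (bernoulli_pmf (1/2)) (\<lambda>v. if v then return_pmf b else pmf_of_set (arms c)))"

lemma set_pmf_prior: "set_pmf (prior c) \<subseteq> insert b (arms c)"
proof (cases "arms c = {}")
  case False
  then have "set_pmf (pmf_of_set (arms c)) = arms c" using finite_arms by (rule set_pmf_of_set)
  then show ?thesis using False by (auto simp: prior_def split: if_splits)
qed (simp add: prior_def)

lemma expectation_prior:
  fixes f :: "nat \<Rightarrow> real"
  assumes "arms c \<noteq> {}"
  shows "measure_pmf.expectation (prior c) f = f b / 2 + (\<Sum>\<alpha>\<in>arms c. f \<alpha>) / card (arms c) / 2"
  using assms finite_arms
  by (simp add: prior_def)
     (subst pmf_expectation_bind[where A = UNIV]; simp add: UNIV_bool integral_pmf_of_set)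

lemma block_loss_bounds: "0 \<le> block_loss c \<theta>" "block_loss c \<theta> \<le> gap * card (B c)"
proof -
  have "0 \<le> measure_pmf.expectation (hist (prob_of \<theta>) T) (\<lambda>h. \<Sum>t\<in>B c. wrong \<theta> c (snd (h ! t)))"
    "measure_pmf.expectation (hist (prob_of \<theta>) T) (\<lambda>h. \<Sum>t\<in>B c. wrong \<theta> c (snd (h ! t))) \<le> card (B c)"
    by (rule expectation_pmf_bounds[where a = 0 and b = "card (B c)"]; rule sum_wrong_bounds)+
  then show "0 \<le> block_loss c \<theta>" "block_loss c \<theta> \<le> gap * card (B c)"
    unfolding block_loss_def using gap_pos by (auto intro!: mult_left_mono)
qed

text \<open>Conditioning on the good arms of the other contexts leaves a problem in one context,
  where the prior yields half the bound of \<open>block_loss_pair\<close>.\<close>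

lemma expectation_block_loss:
  assumes small: "\<And>\<theta>. valid \<theta> \<Longrightarrow> total \<theta> \<le> n / 4" and c: "c \<in> {1..M}"
  shows "gap * n * card (arms c) / 4 \<le>
    measure_pmf.expectation (Pi_pmf {1..M} b prior) (block_loss c)"
proof (cases "arms c = {}")
  case True
  then show ?thesis
    using expectation_pmf_bounds(1)[of 0 "block_loss c"] block_loss_bounds by simp
next
  case False
  define \<Theta> where "\<Theta> = Pi_pmf ({1..M} - {c}) b prior"
  have bl: "\<bar>block_loss c \<theta>\<bar> \<le> gap * card (B c)" for \<theta> using block_loss_bounds[of c \<theta>] by auto
  have "Pi_pmf {1..M} b prior = Pi_pmf (insert c ({1..M} - {c})) b prior"
    using c by (simp add: insert_absorb)
  also have "\<dots> = bind_pmf (prior c) (\<lambda>v. bind_pmf \<Theta> (\<lambda>\<theta>. return_pmf (\<theta>(c := v))))"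
    unfolding \<Theta>_def by (rule Pi_pmf_insert') auto
  also have "\<dots> = bind_pmf \<Theta> (\<lambda>\<theta>. map_pmf (\<lambda>v. \<theta>(c := v)) (prior c))"
    by (subst bind_commute_pmf) (simp add: map_pmf_def)
  finally have eq: "Pi_pmf {1..M} b prior = \<dots>" .
  have "gap * n * card (arms c) / 4 = measure_pmf.expectation \<Theta> (\<lambda>_. gap * n * card (arms c) / 4)"
    by simp
  also have "\<dots> \<le> measure_pmf.expectation \<Theta> (\<lambda>\<theta>. measure_pmf.expectation (prior c) (\<lambda>v. block_loss c (\<theta>(c := v))))"
  proof (rule expectation_pmf_mono[where B = "gap * card (B c)"])
    fix \<theta>
    show "\<bar>measure_pmf.expectation (prior c) (\<lambda>v. block_loss c (\<theta>(c := v)))\<bar> \<le> gap * card (B c)"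
      using expectation_pmf_bounds[of 0 "\<lambda>v. block_loss c (\<theta>(c := v))" "gap * card (B c)" "prior c"]
        block_loss_bounds by auto
    show "\<bar>gap * n * card (arms c) / 4\<bar> \<le> gap * card (B c)"
      using gap_pos card_block[OF c] by (simp add: abs_mult)
    assume "\<theta> \<in> set_pmf \<Theta>"
    then have \<theta>: "\<And>c'. c' \<in> {1..M} - {c} \<Longrightarrow> \<theta> c' \<in> set_pmf (prior c')"
      using set_Pi_pmf_subset'[of "{1..M} - {c}" b prior] by (auto simp: \<Theta>_def PiE_dflt_def)
    then have "valid (\<theta>(c := b))" using set_pmf_prior by (fastforce simp: valid_def)
    then have "gap * n * card (arms c) / 2 \<le> block_loss c (\<theta>(c := b)) +
        (\<Sum>\<alpha>\<in>arms c. block_loss c (\<theta>(c := \<alpha>))) / card (arms c)"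
      by (intro block_loss_pair[OF c False] small)
    then show "gap * n * card (arms c) / 4 \<le> measure_pmf.expectation (prior c) (\<lambda>v. block_loss c (\<theta>(c := v)))"
      unfolding expectation_prior[OF False] by (simp add: algebra_simps)
  qed
  also have "\<dots> = measure_pmf.expectation (Pi_pmf {1..M} b prior) (block_loss c)"
    unfolding eq by (subst expectation_bind_pmf[OF bl]) simp
  finally show ?thesis .
qed

text \<open>If all totals were below \<rho>, they would be below \<open>n / 4\<close>, and every
  block would lose its share on average over the prior. These shares add up to
  \<open>gap * n * card A / 4 = sqrt n * card A / 64\<close>, which exceeds \<rho>.\<close>

lemma exists_large_total:
  assumes "\<rho> \<le> n / 4" "\<rho> < sqrt n * card A / 64"
  shows "\<exists>\<theta>. valid \<theta> \<and> \<rho> \<le> total \<theta>"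
proof (rule ccontr)
  assume "\<not> ?thesis"
  then have less: "total \<theta> \<le> \<rho>" if "valid \<theta>" for \<theta> using that by force
  let ?\<Theta> = "Pi_pmf {1..M} b prior"
  have bl: "\<bar>block_loss c \<theta>\<bar> \<le> gap * card (B c)" for c \<theta> using block_loss_bounds[of c \<theta>] by auto
  have val: "valid \<theta>" if "\<theta> \<in> set_pmf ?\<Theta>" for \<theta>
    using that set_Pi_pmf_subset'[of "{1..M}" b prior] set_pmf_prior
    by (fastforce simp: valid_def PiE_dflt_def)
  have cardA: "real (card A) = (\<Sum>c=1..M. real (card (arms c)))"
  proof -
    have "A = (\<Union>c\<in>{1..M}. arms c)" using ctx_in by (auto simp: arms_def)
    then have "card A = card (\<Union>c\<in>{1..M}. arms c)" by simp
    also have "\<dots> = (\<Sum>c=1..M. card (arms c))"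
      by (rule card_UN_disjoint) (auto simp: finite_arms, auto simp: arms_def)
    finally show ?thesis by simp
  qed
  have "sqrt n * card A / 64 = gap * n * card A / 4"
    using n by (simp add: gap_def field_simps)
  also have "\<dots> = (\<Sum>c=1..M. gap * n * card (arms c) / 4)"
    unfolding cardA by (simp add: sum_distrib_left sum_divide_distrib)
  also have "\<dots> \<le> (\<Sum>c=1..M. measure_pmf.expectation ?\<Theta> (block_loss c))"
    by (intro sum_mono expectation_block_loss) (use less assms(1) in force)+
  also have "\<dots> = measure_pmf.expectation ?\<Theta> (\<lambda>\<theta>. \<Sum>c=1..M. block_loss c \<theta>)"
    by (rule Bochner_Integration.integral_sum[symmetric]) (rule integrable_pmf_bounded[OF bl])
  also have "\<dots> \<le> measure_pmf.expectation ?\<Theta> (\<lambda>_. \<rho>)"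
  proof (rule expectation_pmf_mono[where B = "(\<Sum>c=1..M. gap * card (B c)) + \<bar>\<rho>\<bar>"])
    fix \<theta>
    have "\<bar>\<Sum>c=1..M. block_loss c \<theta>\<bar> \<le> (\<Sum>c=1..M. gap * card (B c))"
      by (rule order_trans[OF sum_abs sum_mono[OF bl]])
    then show "\<bar>\<Sum>c=1..M. block_loss c \<theta>\<bar> \<le> (\<Sum>c=1..M. gap * card (B c)) + \<bar>\<rho>\<bar>"
      "\<bar>\<rho>\<bar> \<le> (\<Sum>c=1..M. gap * card (B c)) + \<bar>\<rho>\<bar>"
      using abs_ge_zero[of "\<Sum>c=1..M. block_loss c \<theta>"] abs_ge_zero[of \<rho>] by linarith+
    assume "\<theta> \<in> set_pmf ?\<Theta>"
    then show "(\<Sum>c=1..M. block_loss c \<theta>) \<le> \<rho>"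
      using sum_block_loss_le less val by (meson order_trans)
  qed
  finally show False using assms(2) by simp
qed

lemma exists_large_expected_regret:
  assumes "\<rho> \<le> n / 4" "\<rho> < sqrt n * card A / 64"
  shows "\<exists>\<mu> D. environment K M T \<mu> D \<and> \<rho> \<le> expected_regret K M T E \<pi> cs \<mu> D"
proof -
  obtain \<theta> where "\<rho> \<le> total \<theta>" using exists_large_total[OF assms] by blast
  then have "\<rho> \<le> expected_regret K M T E \<pi> cs (mean (prob_of \<theta>)) (\<lambda>_. reward_law (prob_of \<theta>))"
    by (simp add: expected_regret_hist total_def)
  moreover have "environment K M T (mean (prob_of \<theta>)) (\<lambda>_. reward_law (prob_of \<theta>))"
    by (rule environment_reward_law) (use gap_pos gap_le in \<open>auto simp: prob_of_def\<close>)
  ultimately show ?thesis by blast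
qed

end

section \<open>Scheduling the contexts\<close>

lemma (in prob_space) expectation_le_const:
  assumes "AE x in M. f x \<le> c" "0 \<le> c"
  shows "expectation f \<le> (c::real)"
  \<comment> \<open>A non-integrable function has Bochner integral 0, which \<open>0 \<le> c\<close>
    covers.\<close>
  using integral_le_const[of f c] assms not_integrable_integral_eq[of M f] by (cases "integrable M f") auto

lemma expected_regret_le:
  assumes "is_policy K M E \<pi>" "environment K M T \<mu> D" "\<And>t. t < T \<Longrightarrow> cs t \<in> {1..M}" "1 \<le> K"
  shows "expected_regret K M T E \<pi> cs \<mu> D \<le> T"
proof -
  have "prob_space (PiM {..<T} D)"
    using assms(2) by (intro prob_space_PiM) (auto simp: environment_def)
  then interpret P: prob_space "PiM {..<T} D" .
  have \<mu>: "\<mu> c a \<in> {0..1}" if "c \<in> {1..M}" "a \<in> {1..K}" for c a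
    using assms(2) that by (auto simp: environment_def)
  have "measure_pmf.expectation (play M E \<pi> cs r T)
      (\<lambda>h. \<Sum>t<T. Max (\<mu> (cs t) ` {1..K}) - \<mu> (cs t) (snd (h ! t))) \<le> T" for r
  proof (rule measure_pmf.expectation_le_const)
    have "(\<Sum>t<T. Max (\<mu> (cs t) ` {1..K}) - \<mu> (cs t) (snd (h ! t))) \<le> (\<Sum>t<T. 1)"
      if "h \<in> set_pmf (play M E \<pi> cs r T)" for h
    proof (rule sum_mono)
      fix t assume "t \<in> {..<T}"
      then have "cs t \<in> {1..M}" "snd (h ! t) \<in> {1..K}" using assms(3) set_pmf_play[OF assms(1) that] by auto
      then have "Max (\<mu> (cs t) ` {1..K}) \<le> 1" "0 \<le> \<mu> (cs t) (snd (h ! t))"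
        using \<mu> assms(4) by (auto simp: Max_le_iff)
      then show "Max (\<mu> (cs t) ` {1..K}) - \<mu> (cs t) (snd (h ! t)) \<le> 1" by linarith
    qed
    then show "AE h in play M E \<pi> cs r T. (\<Sum>t<T. Max (\<mu> (cs t) ` {1..K}) - \<mu> (cs t) (snd (h ! t))) \<le> T"
      by (simp add: AE_measure_pmf_iff)
  qed simp
  then show ?thesis unfolding expected_regret_def by (intro P.expectation_le_const) auto
qed

text \<open>The bound \<open>T\<close> on expected regrets makes the supremum proper, and a constant
  policy shows that the infimum is over a nonempty set.\<close>

lemma minimax_regret_ge:
  assumes "1 \<le> K"
    and "\<And>\<pi>. is_policy K M E \<pi> \<Longrightarrow> \<exists>cs \<mu> D. (\<forall>t<T. cs t \<in> {1..M}) \<and> environment K M T \<mu> D \<and>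
           \<rho> \<le> expected_regret K M T E \<pi> cs \<mu> D"
  shows "\<rho> \<le> minimax_regret K M T E"
  unfolding minimax_regret_def
proof (rule cInf_greatest)
  have "is_policy K M E (\<lambda>_ _ _. return_pmf 1)" using assms(1) by (auto simp: is_policy_def)
  then show "{regret K M T E \<pi> | \<pi>. is_policy K M E \<pi>} \<noteq> {}" by blast
  fix x assume "x \<in> {regret K M T E \<pi> | \<pi>. is_policy K M E \<pi>}"
  then obtain \<pi> where \<pi>: "is_policy K M E \<pi>" "x = regret K M T E \<pi>" by blast
  obtain cs \<mu> D where "\<forall>t<T. cs t \<in> {1..M}" "environment K M T \<mu> D"
      and \<rho>: "\<rho> \<le> expected_regret K M T E \<pi> cs \<mu> D" using assms(2)[OF \<pi>(1)] by blast
  then have "expected_regret K M T E \<pi> cs \<mu> D \<le> x"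
    unfolding \<pi>(2) regret_def
    by (intro cSup_upper) (auto intro!: bdd_aboveI[where M = "real T"] expected_regret_le[OF \<pi>(1)] assms(1))
  with \<rho> show "\<rho> \<le> x" by simp
qed

text \<open>Contexts come in increasing order: before the end of block \<open>c\<close> only
  contexts up to \<open>c\<close> occur, the direction in which \<open>no_edge\<close> forbids
  observations.\<close>

definition schedule ::
  "nat \<Rightarrow> (nat \<Rightarrow> nat) \<Rightarrow> (nat \<Rightarrow> nat) \<Rightarrow> (nat \<Rightarrow> nat set) \<Rightarrow> bool" where
  "schedule M k cs B \<longleftrightarrow> (\<forall>t. cs t \<in> {1..M}) \<and> (\<forall>c\<in>{1..M}. card (B c) = k c \<and>
     (\<forall>t\<in>B c. cs t = c \<and> t < (\<Sum>j=1..c. k j)) \<and>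
     (\<forall>t < (\<Sum>j=1..c. k j). cs t \<le> c \<and> (cs t = c \<longrightarrow> t \<in> B c)))"

lemma exists_schedule:
  assumes "1 \<le> M"
  shows "\<exists>cs B. schedule M k cs B"
proof -
  define S where "S c = (\<Sum>j=1..c. k j)" for c
  have S: "S 0 = 0" "\<And>c. S (Suc c) = S c + k (Suc c)" by (simp_all add: S_def)
  have mono: "S c \<le> S d" if "c \<le> d" for c d
    using that by (induction rule: dec_induct) (auto simp: S)
  define B where "B c = {S (c - 1)..<S c}" for c
  \<comment> \<open>The first context whose block ends after \<open>t\<close>; rounds left over
    after the last block get the arbitrary context 1.\<close>
  define cs where "cs t = (if t < S M then LEAST c. t < S c else 1)" for t
  have le: "cs t \<le> c" if "t < S c" "c \<le> M" for t c
    using that mono[of c M] by (auto simp: cs_def intro: Least_le)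
  have ge: "1 \<le> cs t" for t
  proof (cases "t < S M")
    case True
    then have "t < S (LEAST c. t < S c)" by (rule LeastI)
    then have "(LEAST c. t < S c) \<noteq> 0" using S by (metis not_less0)
    then show ?thesis using True by (simp add: cs_def)
  qed (simp add: cs_def)
  have "cs t \<in> {1..M}" for t
    using ge[of t] le[of t M] assms by (cases "t < S M") (auto simp: cs_def)
  moreover have "card (B c) = k c" if "c \<in> {1..M}" for c
    using that S(2)[of "c - 1"] by (simp add: B_def)
  moreover have "cs t = c \<and> t < S c" if "c \<in> {1..M}" "t \<in> B c" for c t
  proof -
    have t: "S (c - 1) \<le> t" "t < S c" using that by (auto simp: B_def)
    have "c \<le> cs t"
    proof (rule ccontr)
      assume "\<not> c \<le> cs t"
      then have "S (cs t) \<le> S (c - 1)" by (intro mono) auto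
      moreover have "t < S M" using t(2) mono[of c M] that by auto
      then have "t < S (cs t)" unfolding cs_def by (auto intro: LeastI)
      ultimately show False using t by linarith
    qed
    then show ?thesis using le[OF t(2)] that t by auto
  qed
  moreover have "cs t \<le> c" if "c \<in> {1..M}" "t < S c" for c t
    using le[OF that(2)] that(1) by simp
  moreover have "t \<in> B c" if "c \<in> {1..M}" "t < S c" "cs t = c" for c t
  proof (rule ccontr)
    assume "t \<notin> B c"
    then have "t < S (c - 1)" using that by (auto simp: B_def)
    then have "cs t \<le> c - 1" using that by (intro le) auto
    then show False using that by auto
  qed
  ultimately have "schedule M k cs B" unfolding schedule_def S_def[symmetric] by blast
  then show ?thesis by blast
qed

text \<open>One action of the family serves as \<open>b\<close>, the other \<open>N - 1\<close> are
  the unknown arms; \<open>2 \<le> N\<close> ensures that there is one.\<close>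

lemma exists_bad_environment_of_family:
  assumes pol: "is_policy K M E \<pi>" and E: "E \<subseteq> {1..K} \<times> {1..K}" and M: "1 \<le> M"
    and ind: "\<forall>c\<in>{1..M}. independent_in K E (I c)"
    and disj: "disjoint_family_on I {1..M}"
    and no: "\<forall>i\<in>{1..M}. \<forall>j\<in>{1..M}. i < j \<longrightarrow> no_edge E (I i) (I j)"
    and N: "N = (\<Sum>c=1..M. card (I c))" "2 \<le> N" "N ^ 3 \<le> T"
  shows "\<exists>cs \<mu> D. (\<forall>t<T. cs t \<in> {1..M}) \<and> environment K M T \<mu> D \<and>
           1 / 256 * sqrt (real N * real T) \<le> expected_regret K M T E \<pi> cs \<mu> D"
proof -
  have I_sub: "I c \<subseteq> {1..K}" if "c \<in> {1..M}" for c using ind that by (auto simp: independent_in_def)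
  have finI: "finite (I c)" if "c \<in> {1..M}" for c using I_sub[OF that] finite_subset by blast
  have ex: "\<exists>c. c \<in> {1..M} \<and> I c \<noteq> {}"
  proof (rule ccontr)
    assume "\<not> ?thesis"
    then have "N = (\<Sum>c=1..M. 0)" unfolding N(1) by (intro sum.cong) auto
    with N(2) show False by simp
  qed
  \<comment> \<open>Taking \<open>b\<close> from the first nonempty set makes it blind to all
    unknown arms: it has no edge into later sets, nor to other actions of its own.\<close>
  define c0 where "c0 = (LEAST c. c \<in> {1..M} \<and> I c \<noteq> {})"
  have c0: "c0 \<in> {1..M}" "I c0 \<noteq> {}" using LeastI_ex[OF ex] by (auto simp: c0_def)
  have c0_le: "c0 \<le> c" if "c \<in> {1..M}" "I c \<noteq> {}" for c
    unfolding c0_def using that by (intro Least_le) auto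
  obtain b where b: "b \<in> I c0" using c0 by blast
  define A where "A = (\<Union>c\<in>{1..M}. I c) - {b}"
  define ctx where "ctx a = (THE c. c \<in> {1..M} \<and> a \<in> I c)" for a
  have uniq: "c = c'" if "c \<in> {1..M}" "c' \<in> {1..M}" "a \<in> I c" "a \<in> I c'" for a c c'
    using disj that unfolding disjoint_family_on_def by blast
  have ctx: "ctx a = c" if "c \<in> {1..M}" "a \<in> I c" for a c
    unfolding ctx_def by (rule the_equality) (use that uniq in blast)+
  have cardA: "card A = N - 1"
  proof -
    have "card (\<Union>c\<in>{1..M}. I c) = N"
      unfolding N(1)
    proof (rule card_UN_disjoint)
      show "\<forall>c\<in>{1..M}. finite (I c)" using finI by blast
      show "\<forall>c\<in>{1..M}. \<forall>c'\<in>{1..M}. c \<noteq> c' \<longrightarrow> I c \<inter> I c' = {}"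
        using disj unfolding disjoint_family_on_def .
    qed simp
    moreover have "b \<in> (\<Union>c\<in>{1..M}. I c)" using b c0(1) by blast
    ultimately show ?thesis unfolding A_def by (simp add: card_Diff_singleton)
  qed
  have sumA: "(\<Sum>c=1..M. card (I c - {b})) = card A"
  proof -
    have "A = (\<Union>c\<in>{1..M}. I c - {b})" by (auto simp: A_def)
    then have "card A = card (\<Union>c\<in>{1..M}. I c - {b})" by simp
    also have "\<dots> = (\<Sum>c=1..M. card (I c - {b}))"
    proof (rule card_UN_disjoint)
      show "\<forall>c\<in>{1..M}. finite (I c - {b})" using finI by blast
      show "\<forall>c\<in>{1..M}. \<forall>c'\<in>{1..M}. c \<noteq> c' \<longrightarrow> (I c - {b}) \<inter> (I c' - {b}) = {}"
        using disj unfolding disjoint_family_on_def by blast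
    qed simp
    finally show ?thesis by simp
  qed
  define m where "m = card A"
  have m: "m \<ge> 1" "m < N" "real m \<ge> N / 2" using cardA N(2) by (auto simp: m_def of_nat_diff)
  \<comment> \<open>Rounding down costs at most a factor 2:
    \<open>n * m \<le> T \<le> 2 * n * m\<close>.\<close>
  define n where "n = T div m"
  have "N ^ 3 \<ge> N" using N(2) self_le_power[of N 3] by simp
  then have mT: "m \<le> T" using m N(3) by linarith
  then have n1: "n \<ge> 1" using m by (simp add: n_def div_greater_zero_iff Suc_leI)
  have nT: "n * m \<le> T" by (simp add: n_def)
  have n_ge: "real T \<le> 2 * real n * real m"
  proof -
    have "T = n * m + T mod m" by (simp add: n_def)
    moreover have "T mod m \<le> m" using m by simp
    moreover have "m \<le> n * m" using n1 by simp
    ultimately have "T \<le> 2 * n * m" by linarith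
    then show ?thesis by (metis of_nat_le_iff of_nat_mult of_nat_numeral)
  qed
  define k where "k c = n * card (I c - {b})" for c
  obtain cs B where sched: "schedule M k cs B" using exists_schedule[OF M] by blast
  have cs: "cs t \<in> {1..M}" for t using sched by (simp add: schedule_def)
  interpret bernoulli_bandit K M E \<pi> cs A b ctx
  proof
    show "A \<subseteq> {1..K}" using I_sub unfolding A_def by blast
    show "b \<in> {1..K}" using I_sub[OF c0(1)] b by blast
    show "ctx a \<in> {1..M}" if a: "a \<in> A" for a
    proof -
      obtain c where c: "c \<in> {1..M}" "a \<in> I c" using a unfolding A_def by blast
      then show ?thesis using ctx[OF c] by simp
    qed
    show "b \<notin> A" by (simp add: A_def)
    show "is_policy K M E \<pi>" by (fact pol)
    show "E \<subseteq> {1..K} \<times> {1..K}" by (fact E)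
  qed
  have arms_eq: "arms c = I c - {b}" if "c \<in> {1..M}" for c
  proof -
    have "a \<in> I c" if a: "a \<in> A" "ctx a = c" for a
    proof -
      obtain c' where "c' \<in> {1..M}" "a \<in> I c'" using a unfolding A_def by blast
      then show ?thesis using ctx[of c' a] a by simp
    qed
    moreover have "a \<in> A \<and> ctx a = c" if a: "a \<in> I c - {b}" for a
      using ctx[of c a] a \<open>c \<in> {1..M}\<close> unfolding A_def by blast
    moreover have "a \<noteq> b" if "a \<in> A" for a using that by (simp add: A_def)
    ultimately show ?thesis unfolding arms_def by blast
  qed
  interpret block_bandit K M E \<pi> cs A b ctx T n B "\<lambda>c. sum k {1..c}"
  proof
    fix c assume c: "c \<in> {1..M}"
    have "(\<Sum>j=1..c. k j) \<le> (\<Sum>j=1..M. k j)"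
      using c by (intro sum_mono2) auto
    also have "\<dots> = n * m"
      using sumA by (simp add: m_def k_def sum_distrib_left[symmetric])
    finally show "(\<Sum>j=1..c. k j) \<le> T" using nT by simp
  next
    fix \<alpha> t a
    assume \<alpha>: "\<alpha> \<in> A" and t: "t < sum k {1..ctx \<alpha>}"
      and e: "(a, \<alpha>) \<in> E" and a: "a \<in> insert b (arms (cs t))"
    define c where "c = ctx \<alpha>"
    have c: "c \<in> {1..M}" using ctx_in[OF \<alpha>] by (simp add: c_def)
    have "\<alpha> \<in> arms c" unfolding arms_iff c_def using \<alpha> by blast
    then have \<alpha>I: "\<alpha> \<in> I c" "\<alpha> \<noteq> b" unfolding arms_eq[OF c] by blast+
    \<comment> \<open>An edge from \<open>I d\<close> into \<open>I c\<close> is excluded for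
      \<open>d < c\<close> by \<open>no_edge\<close>; for \<open>d = c\<close>, independence leaves
      only a loop.\<close>
    have reach: "d = c \<and> a = \<alpha>" if "d \<in> {1..M}" "d \<le> c" "a \<in> I d" for d
    proof -
      have "\<not> d < c"
      proof
        assume "d < c"
        then have "no_edge E (I d) (I c)" using no that(1) c by blast
        then show False using that(3) e \<alpha>I(1) unfolding no_edge_def by blast
      qed
      then have "d = c" using that(2) by simp
      moreover have "independent_in K E (I c)" using ind c by blast
      ultimately show ?thesis using e \<alpha>I(1) that(3) unfolding independent_in_def by blast
    qed
    have "a \<noteq> b"
    proof
      assume "a = b"
      moreover have "c0 \<le> c" using c0_le[OF c] \<alpha>I(1) by blast
      ultimately show False using reach[OF c0(1)] b \<alpha>I(2) by simp
    qed
    then have aI: "a \<in> I (cs t)" using a arms_eq[OF cs, of t] by simp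
    have ct: "cs t \<le> c" "cs t = c \<Longrightarrow> t \<in> B c"
      using sched c t[folded c_def] unfolding schedule_def by blast+
    have "cs t = c \<and> a = \<alpha>" using reach[OF cs ct(1) aI] .
    then show "t \<in> B (ctx \<alpha>) \<and> (a = \<alpha> \<or> arms (ctx \<alpha>) = {\<alpha>})"
      using ct(2) unfolding c_def by simp
  next
    show "card (B c) = n * card (arms c)" if "c \<in> {1..M}" for c
      using sched that arms_eq[OF that] by (simp add: schedule_def k_def)
    show "cs t = c \<and> t < sum k {1..c}" if "c \<in> {1..M}" "t \<in> B c" for c t
      using sched that unfolding schedule_def by blast
  qed (fact n1)
  let ?\<rho> = "1 / 256 * sqrt (real N * real T)"
  have T0: "real T > 0" "real N > 0" using m mT by auto
  \<comment> \<open>Here \<open>N ^ 3 \<le> T\<close> enters: it gives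
    \<open>sqrt (N * T) \<le> T / N\<close>, which is at most \<open>2 * n\<close>.\<close>
  have small: "?\<rho> \<le> n / 4"
  proof -
    have "real N ^ 3 \<le> real T" using N(3) by (metis of_nat_le_iff of_nat_power)
    then have "real N * real T * real N ^ 2 \<le> real T ^ 2"
      using T0 by (simp add: power2_eq_square power3_eq_cube mult.commute mult.left_commute)
    then have "sqrt (real N * real T) \<le> real T / real N"
      using T0 by (intro real_le_lsqrt) (auto simp: power_divide field_simps)
    also have "\<dots> \<le> real T / real m" using m T0 by (intro divide_left_mono) auto
    also have "\<dots> \<le> 2 * n" using n_ge m by (simp add: field_simps)
    finally show ?thesis by simp
  qed
  \<comment> \<open>From \<open>m \<ge> N / 2\<close> and \<open>T \<le> 2 * n * m\<close> follows
    \<open>N * T / 4 \<le> n * m\<^sup>2\<close>; a factor 2 remains for strictness.\<close>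
  have "?\<rho> < sqrt n * card A / 64"
  proof -
    have "real N / 4 * real T \<le> real m / 2 * (2 * real n * real m)"
      using m n_ge by (intro mult_mono) auto
    then have "sqrt (real N / 4 * real T) \<le> sqrt (real n * (real m)\<^sup>2)"
      by (intro real_sqrt_le_mono) (simp add: power2_eq_square mult_ac)
    then have "sqrt (real N * real T) / 2 \<le> sqrt n * m"
      by (simp add: real_sqrt_mult real_sqrt_divide)
    moreover have "sqrt (real N * real T) > 0" using T0 by simp
    ultimately show ?thesis unfolding m_def[symmetric] by linarith
  qed
  from exists_large_expected_regret[OF small this] obtain \<mu> D where
    "environment K M T \<mu> D" "?\<rho> \<le> expected_regret K M T E \<pi> cs \<mu> D" by blast
  then show ?thesis using cs by (intro exI[of _ cs] exI[of _ \<mu>] exI[of _ D] conjI allI impI)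
qed

text \<open>Action 1 is the known one, action 2 the only unknown arm, and one block fills all
  \<open>T\<close> rounds. Through its alternative \<open>arms (ctx \<alpha>) = {\<alpha>}\<close>,
  \<open>reveal\<close> then holds for every graph.\<close>

lemma exists_bad_environment_two_actions:
  assumes pol: "is_policy K M E \<pi>" and E: "E \<subseteq> {1..K} \<times> {1..K}" and "1 \<le> M" "2 \<le> K" "1 \<le> T"
  shows "\<exists>cs \<mu> D. (\<forall>t<T. cs t \<in> {1..M}) \<and> environment K M T \<mu> D \<and>
           1 / 256 * sqrt (real T) \<le> expected_regret K M T E \<pi> cs \<mu> D"
proof -
  interpret bernoulli_bandit K M E \<pi> "\<lambda>_. 1" "{2}" 1 "\<lambda>_. 1"
    by standard (use assms in auto)
  have arms_eq: "arms c = (if c = 1 then {2} else {})" for c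
    unfolding arms_def by auto
  interpret block_bandit K M E \<pi> "\<lambda>_. 1" "{2}" 1 "\<lambda>_. 1" T T
      "\<lambda>c. if c = 1 then {..<T} else {}" "\<lambda>c. if c = 1 then T else 0"
    by standard (use assms in \<open>auto simp: arms_eq simp del: One_nat_def split: if_splits\<close>)
  have "sqrt T * 1 \<le> sqrt T * sqrt T" using assms by (intro mult_left_mono) auto
  then have "1 / 256 * sqrt T \<le> T / 4" "1 / 256 * sqrt T < sqrt T * card {2::nat} / 64"
    using assms by auto
  from exists_large_expected_regret[OF this] show ?thesis
    using \<open>1 \<le> M\<close> by (intro exI[of _ "\<lambda>_. 1"]) auto
qed

text \<open>For \<open>K = 1\<close> the regret vanishes while \<open>beta\<close> equals 1, so the
  bound can hold only from \<open>2 \<le> K\<close> on.\<close>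

theorem theorem1p1:
  "\<exists>c\<^sub>0 > (0::real). \<forall>(K::nat) (M::nat) (T::nat) (E :: (nat \<times> nat) set).
     2 \<le> K \<longrightarrow> 1 \<le> M \<longrightarrow> 1 \<le> T \<longrightarrow>
     E \<subseteq> {1..K} \<times> {1..K} \<longrightarrow> strongly_observable K E \<longrightarrow>
     beta K M E ^ 3 \<le> T \<longrightarrow>
     minimax_regret K M T E \<ge> c\<^sub>0 * sqrt (real (beta K M E) * real T)"
proof (intro exI[of _ "1 / 256"] conjI allI impI)
  fix K M T :: nat and E :: "(nat \<times> nat) set"
  assume K: "2 \<le> K" and M: "1 \<le> M" and T: "1 \<le> T" and E: "E \<subseteq> {1..K} \<times> {1..K}"
    and large: "beta K M E ^ 3 \<le> T"
  let ?N = "beta K M E"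
  let ?ok = "\<lambda>I. (\<forall>c\<in>{1..M}. independent_in K E (I c)) \<and> disjoint_family_on I {1..M} \<and>
     (\<forall>i\<in>{1..M}. \<forall>j\<in>{1..M}. i < j \<longrightarrow> no_edge E (I i) (I j))"
  let ?S = "{\<Sum>c=1..M. card (I c) | I. ?ok I}"
  have "?S \<subseteq> {..M * K}"
  proof
    fix s assume "s \<in> ?S"
    then obtain I where I: "s = (\<Sum>c=1..M. card (I c))" "\<forall>c\<in>{1..M}. independent_in K E (I c)" by blast
    have "card (I c) \<le> K" if "c \<in> {1..M}" for c
      using card_mono[of "{1..K}" "I c"] I(2) that by (auto simp: independent_in_def)
    then have "s \<le> (\<Sum>c=1..M. K)" unfolding I(1) by (rule sum_mono)
    then show "s \<in> {..M * K}" by simp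
  qed
  then have fin: "finite ?S" by (rule finite_subset) simp
  have ok0: "?ok (\<lambda>_. {})"
    by (auto simp: independent_in_def disjoint_family_on_def no_edge_def)
  have "(\<Sum>c=1..M. card ({} :: nat set)) \<in> ?S"
    by (rule CollectI, rule exI[of _ "\<lambda>_. {}"], rule conjI[OF refl ok0])
  then have "?S \<noteq> {}" by (metis empty_iff)
  \<comment> \<open>The maximum defining \<open>beta\<close> is attained, since the set of values is
    finite and contains the value of the empty family.\<close>
  with fin have "?N \<in> ?S" unfolding beta_def by (rule Max_in)
  then obtain I where I: "?N = (\<Sum>c=1..M. card (I c))" and ok: "?ok I" by (elim CollectE exE conjE) simp
  show "minimax_regret K M T E \<ge> 1 / 256 * sqrt (real ?N * real T)"
  proof (cases "2 \<le> ?N")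
    case True
    show ?thesis
    proof (rule minimax_regret_ge)
      fix \<pi> assume "is_policy K M E \<pi>"
      then show "\<exists>cs \<mu> D. (\<forall>t<T. cs t \<in> {1..M}) \<and> environment K M T \<mu> D \<and>
           1 / 256 * sqrt (real ?N * real T) \<le> expected_regret K M T E \<pi> cs \<mu> D"
        by (rule exists_bad_environment_of_family[OF _ E M _ _ _ I True large]) (use ok in simp_all)
    qed (use K in simp)
  next
    case False
    \<comment> \<open>With \<open>beta\<close> at most 1, a bound of order \<open>sqrt T\<close>
      suffices, and two actions provide it.\<close>
    then have "real ?N * real T \<le> 1 * real T" by (intro mult_right_mono) auto
    then have "1 / 256 * sqrt (real ?N * real T) \<le> 1 / 256 * sqrt (real T)" by simp
    also have "\<dots> \<le> minimax_regret K M T E"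
    proof (rule minimax_regret_ge)
      fix \<pi> assume "is_policy K M E \<pi>"
      then show "\<exists>cs \<mu> D. (\<forall>t<T. cs t \<in> {1..M}) \<and> environment K M T \<mu> D \<and>
           1 / 256 * sqrt (real T) \<le> expected_regret K M T E \<pi> cs \<mu> D"
        by (rule exists_bad_environment_two_actions[OF _ E M K T])
    qed (use K in simp)
    finally show ?thesis .
  qed
qed simp

end
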